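(* There is an absolute constant $C>0$ such that for every integer $q \geq 3$, the quantity $$\sum_{\substack{\chi \bmod q\\ \chi \neq \chi_0}} |L(1, \chi)|^2 - \Big[\phi(q) \sum_{\substack{a=1 \\ (a, q)=1}}^{q} \frac{1}{a^2} - \frac{\phi^2(q)}{q^2} \Big(\log q + \sum_{p\mid q} \frac{\log p}{p-1} \Big)^2 + \frac{\gamma^2 \phi^2(q)}{q^2} + \frac{2\phi(q)}{q^2} \sum_{n \geq 1} \frac{(-1)^n \zeta(n+1)\, q^{1-n}}{n} \sum_{k\mid q} \mu\Big(\frac{q}{k}\Big) \big(B_n(k+1) - B_n(1)\big) + \frac{\phi(q)}{q^2} \sum_{n \geq 0} \frac{c_n}{n+1}\, q^{-n} \sum_{k\mid q} \mu\Big(\frac{q}{k}\Big) \big(B_{n+1}(k+1) - B_{n+1}(1)\big)\Big]$$ has absolute value at most $C\,\dfrac{d(q)\phi(q)}{q^2}$, where the sum on the left runs over all Dirichlet characters $\chi$ modulo $q$ other than the principal character $\chi_0$.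
   Context: For a Dirichlet character $\chi \bmod q$, $L(s,\chi)$ denotes the Dirichlet $L$-series $\sum_{n\ge1}\chi(n)n^{-s}$ (for $\operatorname{Re} s>1$) and its analytic continuation. $\chi_0$ is the principal character mod $q$; $\phi$ is Euler's totient function; $\mu$ is the Möbius function; $d(q)$ is the number of positive divisors of $q$; $p$ denotes primes; $\gamma$ is Euler's constant; $\zeta$ is the Riemann zeta function; $B_n(x)$ is the Bernoulli polynomial of degree $n$. Define $a_0=\gamma$ and $a_n=(-1)^n\zeta(n+1)$ for $n\ge1$, and $c_n=\sum_{i+j=n,\, i,j\ge0} a_i a_j$ for $n\ge 0$.
   Formalization: As printed, both series over n diverge for every q ≥ 3 (the term k = q of the inner sum leaves terms not tending to 0); a factor (q/k)^{n-1} in the first series and (q/k)^n in the second is inserted inside the sums over k | q. *)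

theory Defs
  imports
    "HOL-Complex_Analysis.Complex_Analysis"
    "HOL-Number_Theory.Number_Theory"
    "HOL-Computational_Algebra.Computational_Algebra"
begin

definition dirichlet_character :: "nat \<Rightarrow> (nat \<Rightarrow> complex) \<Rightarrow> bool" where
  "dirichlet_character q X \<longleftrightarrow>
     (\<forall>m n. X (m * n) = X m * X n) \<and>
     (\<forall>n. X (n + q) = X n) \<and>
     (\<forall>n. X n \<noteq> 0 \<longleftrightarrow> coprime n q)"

definition principal_character :: "nat \<Rightarrow> nat \<Rightarrow> complex" where
  "principal_character q n = (if coprime n q then 1 else 0)"

definition dirichlet_series :: "(nat \<Rightarrow> complex) \<Rightarrow> complex \<Rightarrow> complex" where
  "dirichlet_series X s = (\<Sum>n. X (Suc n) / of_nat (Suc n) powr s)"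

(* The value at s of the analytic continuation of the Dirichlet series from Re w > 1 to a
   domain containing s.  It does not depend on the domain, because the L-function of a
   Dirichlet character is single-valued on the complex plane, apart from the pole at 1 that
   it has for the principal character. *)
definition dirichlet_L :: "complex \<Rightarrow> (nat \<Rightarrow> complex) \<Rightarrow> complex" where
  "dirichlet_L s X = (THE z. \<exists>S f.
     open S \<and> connected S \<and> {w. 1 < Re w} \<subseteq> S \<and> s \<in> S \<and>
     f holomorphic_on S \<and> (\<forall>w. 1 < Re w \<longrightarrow> f w = dirichlet_series X w) \<and> f s = z)"

(* Only meant for real arguments greater than 1. *)
definition zeta :: "real \<Rightarrow> real" where
  "zeta s = (\<Sum>n. 1 / real (Suc n) powr s)"

definition moebius :: "nat \<Rightarrow> int" where
  "moebius n = (if squarefree n then (-1) ^ card (prime_factors n) else 0)"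

definition num_divisors :: "nat \<Rightarrow> nat" where
  "num_divisors n = card {k. k dvd n}"

(* Generating function t * exp (x * t) / (exp t - 1) = (\<Sum>n. B_n(x) * t ^ n / n!). *)
definition bernoulli_poly :: "nat \<Rightarrow> real \<Rightarrow> real" where
  "bernoulli_poly n x = fact n * fps_nth (fps_X * fps_exp x / (fps_exp 1 - 1)) n"

definition coeff_a :: "nat \<Rightarrow> real" where
  "coeff_a n = (if n = 0 then euler_mascheroni else (-1) ^ n * zeta (real n + 1))"

definition coeff_c :: "nat \<Rightarrow> real" where
  "coeff_c n = (\<Sum>i\<le>n. coeff_a i * coeff_a (n - i))"

(* For n > 0,  coprime_bernoulli_sum q n  is  n * (\<Sum>a\<in>{1..q} with coprime a q. a ^ (n-1)).
   It comes from  B_n(k+1) - B_n(1) = n * (\<Sum>m=1..k. m ^ (n-1))  and from Moebius inversion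
   of  (\<Sum>m=1..q. (m/q) ^ (n-1)) = (\<Sum>k dvd q. \<Sum>b\<in>{1..k} with coprime b k. (b/k) ^ (n-1)).
   The weight (q/k) ^ (n-1) depends on k and cannot be dropped: without it the term m = k = q
   is not cancelled, and the two series over n in which this sum is used, with the factors
   q powi (1-n) and (after shifting n) q powi (-n), have terms that do not tend to 0. *)
definition coprime_bernoulli_sum :: "nat \<Rightarrow> nat \<Rightarrow> real" where
  "coprime_bernoulli_sum q n =
     (\<Sum>k | k dvd q. of_int (moebius (q div k)) * (real q / real k) ^ (n - 1) *
        (bernoulli_poly n (real k + 1) - bernoulli_poly n 1))"

end

theory Submission
  imports Defs
begin

text \<open>
  For a non-principal character \<open>\<chi>\<close> modulo \<open>q\<close> one has \<open>L(1, \<chi>) = - (\<Sum>a. \<chi>(a) \<psi>(a/q)) / q\<close>, where \<open>\<psi>\<close>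
  is the digamma function and \<open>a\<close> runs over the residues coprime to \<open>q\<close>. Orthogonality of characters
  turns the sum of \<open>|L(1, \<chi>)|\<^sup>2\<close> into \<open>(\<phi>(q) \<Sum>a. \<psi>(a/q)\<^sup>2 - (\<Sum>a. \<psi>(a/q))\<^sup>2) / q\<^sup>2\<close>. The second sum is given
  exactly by Gauss's formula for \<open>\<Sum>b=1..n. \<psi>(b/n)\<close> and Moebius inversion. In the first sum one inserts
  \<open>\<psi>(x) = - 1/x - (\<Sum>n. a\<^sub>n x^n)\<close> and expands the square; the sums of powers of \<open>a\<close> are the Bernoulli
  sums. Everything matches exactly, except for the cross term of \<open>1/x\<close> with \<open>a\<^sub>0 = \<gamma>\<close>: the error is
  \<open>2 \<gamma> \<phi>(q) / q\<close> times the error in approximating \<open>\<Sum>a. 1/a\<close> by means of \<open>H\<^sub>n = ln n + \<gamma> + O(1/n)\<close>,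
  which is at most \<open>d(q) / q\<close>.
\<close>

section \<open>Characters modulo q\<close>

text \<open>
  A subgroup of the group of units modulo \<open>q\<close> is represented by a set \<open>H\<close> of natural numbers
  that is closed under congruence; inverses in \<open>H\<close> exist because of Euler's theorem.
\<close>

definition partial_character :: "nat \<Rightarrow> nat set \<Rightarrow> (nat \<Rightarrow> complex) \<Rightarrow> bool" where
  "partial_character q H X \<longleftrightarrow>
     H \<subseteq> {n. coprime n q} \<and> 1 \<in> H \<and>
     (\<forall>m\<in>H. \<forall>n\<in>H. m * n \<in> H \<and> X (m * n) = X m * X n) \<and>
     (\<forall>m n. [m = n] (mod q) \<longrightarrow> m \<in> H \<longrightarrow> n \<in> H \<and> X m = X n) \<and>
     (\<forall>m\<in>H. X m \<noteq> 0)"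

lemma partial_character_one:
  assumes "partial_character q H X"
  shows "X 1 = 1"
proof -
  have "1 \<in> H" "X (1 * 1) = X 1 * X 1" "X 1 \<noteq> 0"
    using assms unfolding partial_character_def by blast+
  then show ?thesis by simp
qed

lemma partial_character_power:
  assumes "partial_character q H X" "a \<in> H"
  shows "a ^ k \<in> H \<and> X (a ^ k) = X a ^ k"
proof (induction k)
  case 0
  then show ?case
    using assms partial_character_one[OF assms(1)] unfolding partial_character_def by simp
next
  case (Suc k)
  then show ?case
    using assms unfolding partial_character_def by (metis power_Suc)
qed

text \<open>Every element of the subgroup generated by \<open>H\<close> and \<open>a\<close> is
  congruent to some \<open>h * a ^ k\<close> with \<open>h\<close> in \<open>H\<close>, and the
  extension has to send it to \<open>X h * w ^ k\<close>. Two such representations differ by a power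
  of \<open>a ^ m\<close>, on which \<open>w ^ m = X (a ^ m)\<close> ensures agreement. Any
  \<open>m\<close>-th root \<open>w\<close> may be chosen, and this freedom later yields a character
  with a prescribed nontrivial value.\<close>

lemma partial_character_extend:
  assumes pc: "partial_character q H X" and q: "q > 0" and a: "coprime a q"
    and m: "m > 0" "a ^ m \<in> H" and min: "\<And>j. j > 0 \<Longrightarrow> a ^ j \<in> H \<Longrightarrow> m \<le> j"
    and w: "w ^ m = X (a ^ m)"
  obtains H' X' where "partial_character q H' X'" "H \<subseteq> H'" "a \<in> H'" "X' a = w"
    "\<forall>n\<in>H. X' n = X n"
proof -
  have Hcop: "\<And>n. n \<in> H \<Longrightarrow> coprime n q" and H1: "1 \<in> H"
    and Hmult: "\<And>m n. m \<in> H \<Longrightarrow> n \<in> H \<Longrightarrow> m * n \<in> H"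
    and Xmult: "\<And>m n. m \<in> H \<Longrightarrow> n \<in> H \<Longrightarrow> X (m * n) = X m * X n"
    and Hcong: "\<And>m n. [m = n] (mod q) \<Longrightarrow> m \<in> H \<Longrightarrow> n \<in> H"
    and Xcong: "\<And>m n. [m = n] (mod q) \<Longrightarrow> m \<in> H \<Longrightarrow> X m = X n"
    and Xnz: "\<And>n. n \<in> H \<Longrightarrow> X n \<noteq> 0"
    using pc unfolding partial_character_def by blast+
  note X1 = partial_character_one[OF pc]
  note pow = partial_character_power[OF pc]
  have T: "totient q > 0" using q by simp
  define T where "T = totient q"
  have aT: "[a ^ T = 1] (mod q)" unfolding T_def by (rule euler_theorem[OF a])
  have w0: "w \<noteq> 0" using w m Xnz[OF m(2)] by (metis power_0_left not_gr_zero)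
  have dvd: "m dvd j" if j: "a ^ j \<in> H" for j
  proof -
    define r d where "r = j mod m" and "d = j div m"
    \<comment> \<open>Modulo \<open>q\<close> the factor \<open>(a ^ m) ^ (d * (T - 1))\<close> is
      inverse to \<open>a ^ (m * d)\<close>, since \<open>a ^ T\<close> is congruent to 1. It lies
      in \<open>H\<close>, so \<open>a ^ r\<close> does too, and minimality of \<open>m\<close>
      forces \<open>r = 0\<close>.\<close>
    have "a ^ j * (a ^ m) ^ (d * (T - 1)) = a ^ r * (a ^ T) ^ (m * d)"
    proof -
      have "j + m * (d * (T - 1)) = r + T * (m * d)"
      proof -
        obtain T' where "T = Suc T'" using T T_def gr0_implies_Suc by blast
        moreover have "j = r + m * d" by (simp add: r_def d_def)
        ultimately show ?thesis by (simp add: algebra_simps)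
      qed
      then show ?thesis by (metis power_add power_mult)
    qed
    moreover have "[a ^ r * (a ^ T) ^ (m * d) = a ^ r * 1 ^ (m * d)] (mod q)"
      by (intro cong_mult cong_pow aT) simp
    moreover have "a ^ j * (a ^ m) ^ (d * (T - 1)) \<in> H"
      using Hmult j pow m by blast
    ultimately have "a ^ r \<in> H" using Hcong by fastforce
    moreover have "r < m" using m by (simp add: r_def)
    ultimately have "r = 0" using min[of r] by (cases "r = 0") auto
    then show ?thesis by (simp add: r_def mod_eq_0_iff_dvd)
  qed
  \<comment> \<open>\<open>R n h k\<close> records that \<open>h * a ^ k\<close> represents the
    class of \<open>n\<close>.\<close>
  define R where "R n h k \<longleftrightarrow> h \<in> H \<and> [n = h * a ^ k] (mod q)" for n h k
  have wd_le: "X h * w ^ k = X h' * w ^ l" if "R n h k" "R n h' l" "l \<le> k" for n h k h' l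
  proof -
    have hH: "h \<in> H" "h' \<in> H" using that by (auto simp: R_def)
    have "[h * a ^ k = h' * a ^ l] (mod q)"
      using that unfolding R_def by (meson cong_sym cong_trans)
    moreover have "h * a ^ k = h * a ^ (k - l) * a ^ l"
      using that by (simp add: mult.assoc flip: power_add)
    moreover have "coprime (a ^ l) q" using a by simp
    ultimately have c: "[h * a ^ (k - l) = h'] (mod q)"
      by (metis cong_mult_rcancel_nat)
    have hT: "[h ^ T = 1] (mod q)" unfolding T_def by (rule euler_theorem[OF Hcop[OF hH(1)]])
    \<comment> \<open>The power \<open>h ^ (T - 1)\<close> is an inverse of \<open>h\<close> modulo
      \<open>q\<close>, so the quotient of \<open>h'\<close> by \<open>h\<close>, which is
      \<open>a ^ (k - l)\<close>, lies in \<open>H\<close>. Hence \<open>m\<close> divides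
      \<open>k - l\<close>.\<close>
    have "[h ^ (T - 1) * h' = h ^ (T - 1) * (h * a ^ (k - l))] (mod q)"
      by (rule cong_mult) (use c in \<open>auto simp: cong_sym_eq\<close>)
    moreover have "h ^ (T - 1) * (h * a ^ (k - l)) = h ^ T * a ^ (k - l)"
      using T unfolding T_def by (metis mult.assoc power_minus_mult)
    moreover have "[h ^ T * a ^ (k - l) = 1 * a ^ (k - l)] (mod q)"
      by (intro cong_mult hT) simp
    ultimately have "[h ^ (T - 1) * h' = a ^ (k - l)] (mod q)"
      by (metis cong_trans mult_1)
    moreover have "h ^ (T - 1) * h' \<in> H" using Hmult pow hH by blast
    ultimately have akl: "a ^ (k - l) \<in> H" using Hcong by blast
    then obtain t where t: "k - l = m * t" using dvd by blast
    have "X (a ^ (k - l)) = w ^ (k - l)"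
      using pow[OF m(2), of t] by (simp add: t power_mult w)
    moreover have "X h * X (a ^ (k - l)) = X h'"
      using Xmult[OF hH(1) akl] Xcong[OF c] Hmult[OF hH(1) akl] by simp
    moreover have "w ^ k = w ^ (k - l) * w ^ l"
      using that by (simp flip: power_add)
    ultimately show ?thesis by simp
  qed
  have wd: "X h * w ^ k = X h' * w ^ l" if "R n h k" "R n h' l" for n h k h' l
    using wd_le[OF that] wd_le[OF that(2,1)] by (metis nat_le_linear)
  define H' where "H' = {n. \<exists>h k. R n h k}"
  define X' where "X' n = (THE z. \<exists>h k. R n h k \<and> z = X h * w ^ k)" for n
  have X': "X' n = X h * w ^ k" if "R n h k" for n h k
    unfolding X'_def by (rule the_equality) (use that wd in blast)+
  have Rmult: "R (n * n') (h * h') (k + k')" if "R n h k" "R n' h' k'" for n n' h h' k k'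
  proof -
    have "[n * n' = (h * a ^ k) * (h' * a ^ k')] (mod q)"
      using that unfolding R_def by (intro cong_mult) auto
    then show ?thesis using that Hmult unfolding R_def by (simp add: power_add mult_ac)
  qed
  have Rcong: "R n' h k" if "[n = n'] (mod q)" "R n h k" for n n' h k
    using that unfolding R_def by (meson cong_sym cong_trans)
  have RH: "R n n 0" if "n \<in> H" for n using that by (simp add: R_def)
  have Ra: "R a 1 1" using H1 by (simp add: R_def)
  have "partial_character q H' X'"
    unfolding partial_character_def
  proof (intro conjI subsetI ballI allI impI)
    fix n assume "n \<in> H'"
    then obtain h k where R: "R n h k" by (auto simp: H'_def)
    then have "coprime (h * a ^ k) q" using a Hcop by (auto simp: R_def)
    then have "coprime n q" using R unfolding R_def by (meson cong_imp_coprime cong_sym)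
    then show "n \<in> {n. coprime n q}" by simp
  next
    show "1 \<in> H'" using RH[OF H1] by (auto simp: H'_def)
  next
    fix n n' assume "n \<in> H'" "n' \<in> H'"
    then obtain h k h' k' where R: "R n h k" "R n' h' k'" by (auto simp: H'_def)
    show "n * n' \<in> H'" using Rmult[OF R] by (auto simp: H'_def)
    have "h \<in> H" "h' \<in> H" using R by (auto simp: R_def)
    then show "X' (n * n') = X' n * X' n'"
      using X'[OF Rmult[OF R]] X'[OF R(1)] X'[OF R(2)] Xmult by (simp add: power_add)
  next
    fix n n' assume c: "[n = n'] (mod q)" and "n \<in> H'"
    then obtain h k where R: "R n h k" by (auto simp: H'_def)
    show "n' \<in> H'" using Rcong[OF c R] by (auto simp: H'_def)
    show "X' n = X' n'" using X'[OF R] X'[OF Rcong[OF c R]] by simp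
  next
    fix n assume "n \<in> H'"
    then obtain h k where R: "R n h k" by (auto simp: H'_def)
    then show "X' n \<noteq> 0" using X'[OF R] Xnz w0 by (auto simp: R_def)
  qed
  moreover have "H \<subseteq> H'" using RH by (auto simp: H'_def)
  moreover have "a \<in> H'" using Ra by (auto simp: H'_def)
  moreover have "X' a = w" using X'[OF Ra] X1 by simp
  moreover have "X' n = X n" if "n \<in> H" for n using X'[OF RH[OF that]] by simp
  ultimately show ?thesis using that by blast
qed

text \<open>The elements of \<open>A\<close> are adjoined one at a time, each with an
  \<open>m\<close>-th root of a value that is already fixed. The value at \<open>g\<close> is
  carried along because it is what will distinguish the final character from the principal
  one.\<close>

lemma partial_character_extend_all:
  assumes "finite A" "\<forall>a\<in>A. coprime a q" "partial_character q H X" "q > 0" "g \<in> H"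
  obtains H' X' where "partial_character q H' X'" "H \<subseteq> H'" "A \<subseteq> H'" "X' g = X g"
proof -
  have "\<exists>H' X'. partial_character q H' X' \<and> H \<subseteq> H' \<and> A \<subseteq> H' \<and> X' g = X g"
    using assms(1,2)
  proof (induction A rule: finite_induct)
    case empty
    then show ?case using assms by auto
  next
    case (insert a A)
    then obtain H' X' where pc: "partial_character q H' X'" and sub: "H \<subseteq> H'" "A \<subseteq> H'" "X' g = X g"
      by auto
    have a: "coprime a q" using insert by simp
    define m where "m = (LEAST j. j > 0 \<and> a ^ j \<in> H')"
    have "[1 = a ^ totient q] (mod q)" using euler_theorem[OF a] by (rule cong_sym)
    then have "totient q > 0 \<and> a ^ totient q \<in> H'"
      using pc assms(4) unfolding partial_character_def by auto
    then have m: "m > 0 \<and> a ^ m \<in> H'" unfolding m_def by (rule LeastI)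
    have min: "m \<le> j" if "j > 0" "a ^ j \<in> H'" for j
      unfolding m_def using that by (intro Least_le) auto
    obtain w where w: "w ^ m = X' (a ^ m)"
    proof (cases "X' (a ^ m) = 0")
      case True
      then show ?thesis using that[of 0] m by simp
    next
      case False
      then show ?thesis using that[of "exp (ln (X' (a ^ m)) / of_nat m)"] m
        by (simp flip: exp_of_nat_mult)
    qed
    show ?case
    proof (cases "a \<in> H'")
      case True
      then show ?thesis using pc sub by auto
    next
      case False
      have "g \<in> H'" using sub assms by auto
      obtain H'' X'' where "partial_character q H'' X''" "H' \<subseteq> H''" "a \<in> H''"
        "\<forall>n\<in>H'. X'' n = X' n"
        using partial_character_extend[OF pc assms(4) a conjunct1[OF m] conjunct2[OF m] min w] by metis
      then show ?thesis using sub \<open>g \<in> H'\<close> by (metis insert_subset subset_trans)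
    qed
  qed
  then show ?thesis using that by blast
qed

section \<open>Elementary properties of Dirichlet characters\<close>

lemma dirichlet_character_one:
  assumes "dirichlet_character q X"
  shows "X 1 = 1"
proof -
  have "X (1 * 1) = X 1 * X 1" "X 1 \<noteq> 0"
    using assms unfolding dirichlet_character_def by (blast, simp)
  then show ?thesis by simp
qed

lemma dirichlet_character_mult:
  "dirichlet_character q X \<Longrightarrow> X (m * n) = X m * X n"
  unfolding dirichlet_character_def by blast

lemma dirichlet_character_power:
  assumes "dirichlet_character q X"
  shows "X (a ^ k) = X a ^ k"
  by (induction k)
     (use dirichlet_character_one[OF assms] dirichlet_character_mult[OF assms] in auto)

lemma dirichlet_character_eq_0:
  "dirichlet_character q X \<Longrightarrow> \<not> coprime n q \<Longrightarrow> X n = 0"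
  unfolding dirichlet_character_def by blast

lemma dirichlet_character_add_mult:
  assumes "dirichlet_character q X"
  shows "X (n + k * q) = X n"
proof (induction k)
  case (Suc k)
  have "X (n + k * q + q) = X (n + k * q)" using assms unfolding dirichlet_character_def by blast
  then show ?case using Suc by (simp add: algebra_simps)
qed simp

lemma dirichlet_character_mod:
  assumes "dirichlet_character q X"
  shows "X (n mod q) = X n"
  using dirichlet_character_add_mult[OF assms, of "n mod q" "n div q"] by simp

lemma dirichlet_character_cong:
  assumes "dirichlet_character q X" "[m = n] (mod q)"
  shows "X m = X n"
  using assms dirichlet_character_mod unfolding cong_def by metis

lemma dirichlet_character_power_totient:
  assumes "dirichlet_character q X" "coprime a q"
  shows "X a ^ totient q = 1"
  using dirichlet_character_cong[OF assms(1) euler_theorem[OF assms(2)]]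
    dirichlet_character_power[OF assms(1)] dirichlet_character_one[OF assms(1)] by simp

text \<open>On units the values are roots of unity, so conjugation is inversion. Writing the
  conjugate as a value of the same character turns \<open>X a * cnj (X b)\<close> into a single
  value of \<open>X\<close>, to which orthogonality applies.\<close>

lemma dirichlet_character_cnj:
  assumes "dirichlet_character q X" "coprime a q" "q > 0"
  shows "cnj (X a) = X (a ^ (totient q - 1))"
proof -
  have T: "totient q > 0" using assms by simp
  have pow: "X a ^ totient q = 1" by (rule dirichlet_character_power_totient[OF assms(1,2)])
  then have "norm (X a) = 1" using power_eq_1_iff[OF pow] T by simp
  then have "X a * cnj (X a) = 1" using complex_norm_square[of "X a"] by simp
  moreover have "X a * X a ^ (totient q - 1) = 1"
    using pow power_minus_mult[OF T, of "X a"] by (simp add: mult.commute)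
  moreover have "X a \<noteq> 0" using pow T by (auto simp: power_0_left)
  ultimately have "cnj (X a) = X a ^ (totient q - 1)" by (metis mult_left_cancel)
  then show ?thesis by (simp add: dirichlet_character_power[OF assms(1)])
qed

lemma dirichlet_character_principal [simp]:
  "dirichlet_character q (principal_character q)"
  unfolding dirichlet_character_def principal_character_def
proof (intro conjI allI)
  show "(if coprime (n + q) q then 1 else 0 :: complex) = (if coprime n q then 1 else 0)" for n
    by (metis coprime_iff_gcd_eq_1 gcd_add1)
qed (auto simp: coprime_mult_left_iff)

text \<open>A character is determined by its values below \<open>q\<close>, and these are 0 or roots
  of unity of order dividing \<open>totient q\<close>.\<close>

lemma finite_dirichlet_characters:
  assumes "q > 0"
  shows "finite {X. dirichlet_character q X}"
proof -
  define B where "B = insert 0 {z::complex. z ^ totient q = 1}"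
  have "finite {z::complex. z ^ totient q = 1}"
    by (rule finite_roots_unity) (use assms in \<open>simp add: Suc_le_eq\<close>)
  then have "finite (PiE {..<q} (\<lambda>_. B))"
    by (intro finite_PiE) (auto simp: B_def)
  moreover have "(\<lambda>X. restrict X {..<q}) ` {X. dirichlet_character q X} \<subseteq> PiE {..<q} (\<lambda>_. B)"
  proof (rule image_subsetI)
    fix X assume "X \<in> {X. dirichlet_character q X}"
    then have "X n \<in> B" for n
      using dirichlet_character_power_totient[of q X n] dirichlet_character_eq_0[of q X n]
      by (cases "coprime n q") (auto simp: B_def)
    then show "restrict X {..<q} \<in> PiE {..<q} (\<lambda>_. B)" by (simp add: restrict_PiE_iff)
  qed
  moreover have "inj_on (\<lambda>X. restrict X {..<q}) {X. dirichlet_character q X}"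
  proof (rule inj_onI, rule ext)
    fix X Y n
    assume XY: "X \<in> {X. dirichlet_character q X}" "Y \<in> {X. dirichlet_character q X}"
      and eq: "restrict X {..<q} = restrict Y {..<q}"
    have "X (n mod q) = Y (n mod q)"
      using fun_cong[OF eq, of "n mod q"] assms by simp
    then show "X n = Y n"
      using XY dirichlet_character_mod[of q X n] dirichlet_character_mod[of q Y n] by simp
  qed
  ultimately show ?thesis by (metis finite_imageD finite_subset)
qed

text \<open>The trivial character on the class of 1 is extended to the subgroup generated by
  \<open>g\<close>, with a primitive root of unity of the same order as \<open>g\<close> as its
  value there, and then to all units.\<close>

lemma dirichlet_character_separates:
  assumes "q > 0" "coprime g q" "\<not> [g = 1] (mod q)"
  obtains X where "dirichlet_character q X" "X g \<noteq> 1"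
proof -
  define H where "H = {n. [n = 1] (mod q)}"
  have mult1: "[m * n = 1] (mod q)" if "[m = 1] (mod q)" "[n = 1] (mod q)" for m n
    using cong_mult[OF that] by simp
  have pc: "partial_character q H (\<lambda>_. 1)"
    unfolding partial_character_def H_def
  proof (intro conjI subsetI ballI allI impI)
    show "n \<in> {n. coprime n q}" if "n \<in> {n. [n = 1] (mod q)}" for n
      using that by (metis cong_imp_coprime cong_sym coprime_1_left mem_Collect_eq)
    show "m * n \<in> {n. [n = 1] (mod q)}"
      if "m \<in> {n. [n = 1] (mod q)}" "n \<in> {n. [n = 1] (mod q)}" for m n
      using that mult1 by blast
    show "n \<in> {n. [n = 1] (mod q)}" if "[m = n] (mod q)" "m \<in> {n. [n = 1] (mod q)}" for m n
      using that by (metis cong_sym cong_trans mem_Collect_eq)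
  qed auto
  define m where "m = (LEAST j. j > 0 \<and> g ^ j \<in> H)"
  have "totient q > 0 \<and> g ^ totient q \<in> H"
    using assms euler_theorem by (auto simp: H_def)
  then have m: "m > 0 \<and> g ^ m \<in> H" unfolding m_def by (rule LeastI)
  have min: "m \<le> j" if "j > 0" "g ^ j \<in> H" for j
    unfolding m_def using that by (intro Least_le) auto
  \<comment> \<open>Here \<open>m\<close> is the order of \<open>g\<close> modulo \<open>q\<close>.
    It exceeds 1, so the primitive root \<open>w\<close> differs from 1.\<close>
  have "m \<noteq> 1" using m assms by (auto simp: H_def)
  then have m2: "m > 1" using m by linarith
  define w where "w = exp (2 * of_real pi * \<i> * of_nat 1 / of_nat m)"
  have wm: "w ^ m = 1" unfolding w_def using m by (intro complex_root_unity) simp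
  have "\<not> m dvd 1" using m2 by simp
  then have w1: "w \<noteq> 1"
    using complex_root_unity_eq_1[of m 1] m unfolding w_def by simp
  obtain H1 X1 where pc1: "partial_character q H1 X1" "g \<in> H1" "X1 g = w"
    using partial_character_extend[OF pc assms(1,2) conjunct1[OF m] conjunct2[OF m] min wm] by metis
  obtain H2 X2 where pc2: "partial_character q H2 X2" "totatives q \<subseteq> H2" "X2 g = w"
    using partial_character_extend_all[OF _ _ pc1(1) assms(1) pc1(2), of "totatives q"] pc1(3)
    by (metis finite_totatives in_totatives_iff)
  have H2: "n \<in> H2 \<longleftrightarrow> coprime n q" for n
  proof
    show "coprime n q" if "n \<in> H2" using that pc2 unfolding partial_character_def by auto
  next
    assume n: "coprime n q"
    \<comment> \<open>For \<open>q = 1\<close> the remainder \<open>n mod q\<close> is 0, whereas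
      the only totative is 1.\<close>
    define r where "r = (if q = 1 then 1 else n mod q)"
    have r: "[r = n] (mod q)" by (simp add: r_def cong_def)
    then have "coprime r q" using n by (meson cong_imp_coprime cong_sym)
    moreover have "r > 0" using calculation assms(1) by (cases "r = 0") (auto simp: r_def split: if_splits)
    moreover have "r \<le> q" using assms(1) by (simp add: r_def less_imp_le)
    ultimately have "r \<in> totatives q" by (simp add: in_totatives_iff)
    then show "n \<in> H2" using pc2 r unfolding partial_character_def by blast
  qed
  define X where "X n = (if coprime n q then X2 n else 0)" for n
  have "dirichlet_character q X"
    unfolding dirichlet_character_def
  proof (intro conjI allI)
    show "X (m * n) = X m * X n" for m n
      using pc2(1) H2 unfolding X_def partial_character_def by (auto simp: coprime_mult_left_iff)
    show "X (n + q) = X n" for n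
    proof -
      have "[n + q = n] (mod q)" by (simp add: cong_def)
      then show ?thesis
        using pc2(1) H2 unfolding X_def partial_character_def by (metis cong_imp_coprime cong_sym)
    qed
    show "(X n \<noteq> 0) = coprime n q" for n
      using pc2(1) H2 unfolding X_def partial_character_def by auto
  qed
  moreover have "X g \<noteq> 1" using assms pc2 w1 by (simp add: X_def)
  ultimately show ?thesis using that by blast
qed

section \<open>Orthogonality relations\<close>

lemma totatives_cong_eq:
  assumes "q \<ge> 2" "a \<in> totatives q" "b \<in> totatives q" "[a = b] (mod q)"
  shows "a = b"
  using assms by (metis cong_less_modulus_unique_nat totatives_less nat_neq_iff One_nat_def Suc_1 Suc_le_lessD)

text \<open>Multiplication by a unit \<open>b\<close> with \<open>X b \<noteq> 1\<close> permutes
  the residues coprime to \<open>q\<close>, so the sum equals \<open>X b\<close> times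
  itself.\<close>

lemma sum_dirichlet_character:
  assumes q: "q \<ge> 2" and X: "dirichlet_character q X" and neq: "X \<noteq> principal_character q"
  shows "(\<Sum>a\<in>totatives q. X a) = 0"
proof -
  obtain b where b: "X b \<noteq> principal_character q b" using neq by auto
  have cb: "coprime b q"
    using b dirichlet_character_eq_0[OF X] by (auto simp: principal_character_def split: if_splits)
  have Xb: "X b \<noteq> 1" using b cb by (simp add: principal_character_def)
  define h where "h a = b * a mod q" for a
  have h_tot: "h a \<in> totatives q" if "a \<in> totatives q" for a
  proof -
    have "coprime (b * a) q" using cb that by (simp add: in_totatives_iff)
    moreover have "[b * a = h a] (mod q)" by (simp add: h_def cong_def)
    ultimately have c: "coprime (h a) q" by (meson cong_imp_coprime)
    then have "h a > 0" using q by (cases "h a = 0") auto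
    moreover have "h a < q" using q by (simp add: h_def)
    ultimately show ?thesis using c by (simp add: in_totatives_iff)
  qed
  have inj: "inj_on h (totatives q)"
  proof (rule inj_onI)
    fix x y assume xy: "x \<in> totatives q" "y \<in> totatives q" "h x = h y"
    then have "[b * x = b * y] (mod q)" by (simp add: h_def cong_def)
    then have "[x = y] (mod q)" using cb by (simp add: cong_mult_lcancel_nat)
    then show "x = y" using totatives_cong_eq[OF q] xy by blast
  qed
  have img: "h ` totatives q = totatives q"
    by (rule endo_inj_surj) (use h_tot inj in auto)
  have "(\<Sum>a\<in>totatives q. X a) = (\<Sum>a\<in>h ` totatives q. X a)" by (simp only: img)
  also have "\<dots> = (\<Sum>a\<in>totatives q. X (h a))" using inj by (simp add: sum.reindex)
  also have "\<dots> = (\<Sum>a\<in>totatives q. X b * X a)"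
    by (intro sum.cong refl) (simp add: h_def dirichlet_character_mod[OF X] dirichlet_character_mult[OF X])
  also have "\<dots> = X b * (\<Sum>a\<in>totatives q. X a)" by (simp add: sum_distrib_left)
  finally show ?thesis using Xb by simp
qed

text \<open>Dual argument: multiplication by a character \<open>Y\<close> with
  \<open>Y a \<noteq> 1\<close> permutes the characters. The number of characters stays unevaluated
  here; it is found afterwards from this very relation.\<close>

lemma sum_over_dirichlet_characters_card:
  assumes q: "q > 0" and a: "coprime a q"
  shows "(\<Sum>X | dirichlet_character q X. X a)
       = (if [a = 1] (mod q) then of_nat (card {X. dirichlet_character q X}) else 0)"
proof (cases "[a = 1] (mod q)")
  case True
  have "X a = 1" if "dirichlet_character q X" for X
    using dirichlet_character_cong[OF that True] dirichlet_character_one[OF that] by simp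
  then have "(\<Sum>X | dirichlet_character q X. X a) = (\<Sum>X | dirichlet_character q X. 1)"
    by (intro sum.cong refl) simp
  then show ?thesis using True by simp
next
  case False
  obtain Y where Y: "dirichlet_character q Y" "Y a \<noteq> 1"
    using dirichlet_character_separates[OF q a False] .
  define D where "D = {X. dirichlet_character q X}"
  define h where "h X = (\<lambda>n. Y n * X n)" for X :: "nat \<Rightarrow> complex"
  have hD: "h X \<in> D" if "X \<in> D" for X
    using that Y(1) unfolding D_def h_def dirichlet_character_def by auto
  have inj: "inj_on h D"
  proof (rule inj_onI, rule ext)
    fix X Z n assume XZ: "X \<in> D" "Z \<in> D" "h X = h Z"
    then have "Y n * X n = Y n * Z n" unfolding h_def by meson
    then show "X n = Z n"
      using XZ Y(1) unfolding D_def dirichlet_character_def by (cases "coprime n q") auto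
  qed
  have img: "h ` D = D"
    by (rule endo_inj_surj) (use hD inj finite_dirichlet_characters[OF q] in \<open>auto simp: D_def\<close>)
  have "(\<Sum>X\<in>D. X a) = (\<Sum>X\<in>h ` D. X a)" by (simp only: img)
  also have "\<dots> = (\<Sum>X\<in>D. h X a)" using inj by (simp add: sum.reindex)
  also have "\<dots> = Y a * (\<Sum>X\<in>D. X a)" by (simp add: h_def sum_distrib_left)
  finally show ?thesis using Y False by (simp add: D_def)
qed

text \<open>The double sum of \<open>X a\<close> over all characters and totatives is computed in
  both orders. Summing over characters first leaves only \<open>a = 1\<close>; summing over
  totatives first leaves only the principal character.\<close>

lemma card_dirichlet_characters:
  assumes q: "q \<ge> 2"
  shows "card {X. dirichlet_character q X} = totient q"
proof -
  define D where "D = {X. dirichlet_character q X}"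
  have fin: "finite D" using finite_dirichlet_characters q by (simp add: D_def)
  have one: "1 \<in> totatives q" using q by (simp add: in_totatives_iff)
  have "of_nat (card D) = (\<Sum>a\<in>totatives q. if a = 1 then of_nat (card D) else (0::complex))"
    using one by simp
  also have "\<dots> = (\<Sum>a\<in>totatives q. \<Sum>X\<in>D. X a)"
  proof (intro sum.cong refl)
    fix a assume a: "a \<in> totatives q"
    have "[a = 1] (mod q) \<longleftrightarrow> a = 1" using totatives_cong_eq[OF q a one] by auto
    then show "(if a = 1 then of_nat (card D) else 0) = (\<Sum>X\<in>D. X a)"
      using sum_over_dirichlet_characters_card[of q a] a q
      by (simp add: D_def in_totatives_iff)
  qed
  also have "\<dots> = (\<Sum>X\<in>D. \<Sum>a\<in>totatives q. X a)" by (rule sum.swap)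
  also have "\<dots> = (\<Sum>X\<in>D. if X = principal_character q then of_nat (totient q) else 0)"
  proof (intro sum.cong refl)
    fix X assume X: "X \<in> D"
    have "(\<Sum>a\<in>totatives q. principal_character q a) = of_nat (totient q)"
      by (simp add: principal_character_def in_totatives_iff totient_def)
    then show "(\<Sum>a\<in>totatives q. X a) = (if X = principal_character q then of_nat (totient q) else 0)"
      using sum_dirichlet_character[OF q] X by (auto simp: D_def)
  qed
  also have "\<dots> = of_nat (totient q)" using fin by (simp add: D_def)
  finally show ?thesis by (simp only: D_def of_nat_eq_iff)
qed

text \<open>After the square is expanded, orthogonality over the characters leaves only the diagonal
  terms \<open>a = b\<close>.\<close>

lemma dirichlet_character_parseval:
  fixes f :: "nat \<Rightarrow> complex"
  assumes q: "q \<ge> 2"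
  shows "(\<Sum>X | dirichlet_character q X. (cmod (\<Sum>a\<in>totatives q. X a * f a))\<^sup>2)
       = real (totient q) * (\<Sum>a\<in>totatives q. (cmod (f a))\<^sup>2)"
proof -
  define D where "D = {X. dirichlet_character q X}"
  have orth: "(\<Sum>X\<in>D. X a * cnj (X b)) = (if a = b then of_nat (totient q) else 0)"
    if ab: "a \<in> totatives q" "b \<in> totatives q" for a b
  proof -
    \<comment> \<open>\<open>b'\<close> represents the inverse of \<open>b\<close> modulo
      \<open>q\<close>, and \<open>cnj (X b) = X b'\<close>.\<close>
    define b' where "b' = b ^ (totient q - 1)"
    have cop: "coprime a q" "coprime b q" using ab by (auto simp: in_totatives_iff)
    have "totient q > 0" using q by simp
    then have "b' * b = b ^ totient q" unfolding b'_def by (rule power_minus_mult)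
    then have bb: "[b' * b = 1] (mod q)" using euler_theorem[OF cop(2)] by simp
    have "X a * cnj (X b) = X (a * b')" if "X \<in> D" for X
      using that dirichlet_character_cnj[of q X b] dirichlet_character_mult[of q X a b'] cop q
      by (simp add: D_def b'_def)
    then have "(\<Sum>X\<in>D. X a * cnj (X b)) = (\<Sum>X\<in>D. X (a * b'))" by simp
    also have "\<dots> = (if [a * b' = 1] (mod q) then of_nat (totient q) else 0)"
      using sum_over_dirichlet_characters_card[of q "a * b'"] card_dirichlet_characters[OF q] cop q
      by (simp add: D_def b'_def)
    also have "[a * b' = 1] (mod q) \<longleftrightarrow> a = b"
    proof
      assume "[a * b' = 1] (mod q)"
      then have "[a * b' * b = 1 * b] (mod q)" by (rule cong_mult) simp
      moreover have "[a * (b' * b) = a * 1] (mod q)" using bb by (intro cong_mult) simp_all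
      ultimately have "[a = b] (mod q)" by (metis cong_sym cong_trans mult.assoc mult_1 mult_1_right)
      then show "a = b" using totatives_cong_eq[OF q] ab by blast
    next
      assume "a = b"
      then show "[a * b' = 1] (mod q)" using bb by (simp add: mult.commute)
    qed
    finally show ?thesis .
  qed
  have "of_real (\<Sum>X\<in>D. (cmod (\<Sum>a\<in>totatives q. X a * f a))\<^sup>2)
      = (\<Sum>X\<in>D. (\<Sum>a\<in>totatives q. X a * f a) * cnj (\<Sum>b\<in>totatives q. X b * f b))"
    unfolding of_real_sum complex_norm_square ..
  also have "\<dots> = (\<Sum>X\<in>D. \<Sum>a\<in>totatives q. \<Sum>b\<in>totatives q. f a * cnj (f b) * (X a * cnj (X b)))"
    by (simp add: sum_product mult_ac)
  also have "\<dots> = (\<Sum>a\<in>totatives q. \<Sum>X\<in>D. \<Sum>b\<in>totatives q. f a * cnj (f b) * (X a * cnj (X b)))"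
    by (rule sum.swap)
  also have "\<dots> = (\<Sum>a\<in>totatives q. \<Sum>b\<in>totatives q. \<Sum>X\<in>D. f a * cnj (f b) * (X a * cnj (X b)))"
    by (intro sum.cong refl sum.swap)
  also have "\<dots> = (\<Sum>a\<in>totatives q. \<Sum>b\<in>totatives q. if a = b then f a * cnj (f a) * of_nat (totient q) else 0)"
    by (intro sum.cong refl) (simp add: orth flip: sum_distrib_left)
  also have "\<dots> = (\<Sum>a\<in>totatives q. f a * cnj (f a) * of_nat (totient q))" by simp
  also have "\<dots> = of_real (real (totient q) * (\<Sum>a\<in>totatives q. (cmod (f a))\<^sup>2))"
    by (simp add: sum_distrib_left mult.commute flip: complex_norm_square of_real_power)
  finally show ?thesis unfolding D_def of_real_eq_iff .
qed

section \<open>Moebius inversion over the residues coprime to q\<close>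

lemma prime_factorization_prod_distinct_primes:
  fixes S :: "nat set"
  assumes "finite S" "\<forall>p\<in>S. prime p"
  shows "prime_factorization (\<Prod>S) = mset_set S"
proof -
  have "\<Prod>S = prod_mset (mset_set S)" by (simp add: prod_unfold_prod_mset)
  then show ?thesis using prime_factorization_prod_mset_primes[of "mset_set S"] assms by simp
qed

lemma moebius_prod:
  assumes "finite S" "\<forall>p\<in>S. prime p"
  shows "moebius (\<Prod>S) = (-1) ^ card S"
proof -
  have "prime_factorization (\<Prod>S) = mset_set S"
    by (rule prime_factorization_prod_distinct_primes[OF assms])
  then have 1: "prime_factors (\<Prod>S) = S" using assms by simp
  have "squarefree (\<Prod>S)"
    by (rule squarefree_prod_coprime)
       (use assms in \<open>auto simp: squarefree_prime primes_coprime\<close>)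
  then show ?thesis using 1 by (simp add: moebius_def)
qed

text \<open>Only squarefree divisors contribute, and these are the products of the sets of prime
  factors of \<open>n\<close>. The new form of the sum allows induction on the set of
  primes.\<close>

lemma sum_moebius_dvd:
  fixes f :: "nat \<Rightarrow> real"
  assumes n: "n > 0"
  shows "(\<Sum>d | d dvd n. of_int (moebius d) * f d)
       = (\<Sum>S\<in>Pow (prime_factors n). (-1) ^ card S * f (\<Prod>S))"
proof -
  have fin: "finite S" if "S \<subseteq> prime_factors n" for S
    using that finite_subset by blast
  have "(\<Sum>d | d dvd n. of_int (moebius d) * f d)
      = (\<Sum>d | d dvd n \<and> squarefree d. of_int (moebius d) * f d)"
    by (rule sum.mono_neutral_right) (use n in \<open>auto simp: moebius_def\<close>)
  also have "\<dots> = (\<Sum>S\<in>Pow (prime_factors n). of_int (moebius (\<Prod>S)) * f (\<Prod>S))"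
  proof (rule sum.reindex_bij_witness[of _ "\<lambda>S. \<Prod>S" prime_factors])
    fix d assume d: "d \<in> {d. d dvd n \<and> squarefree d}"
    then have "d > 0" using n by (auto intro: Nat.gr0I)
    show p: "\<Prod>(prime_factors d) = d"
    proof -
      have "(\<Prod>p\<in>prime_factors d. p ^ multiplicity p d) = d"
        using prod_prime_factors[of d] \<open>d > 0\<close> by simp
      moreover have "\<forall>p\<in>prime_factors d. multiplicity p d = 1"
        using d \<open>d > 0\<close> squarefree_factorial_semiring'[of d] by auto
      ultimately show ?thesis by simp
    qed
    show "prime_factors d \<in> Pow (prime_factors n)"
      using d n dvd_prime_factors[of n d] by auto
    show "of_int (moebius (\<Prod>(prime_factors d))) * f (\<Prod>(prime_factors d)) = of_int (moebius d) * f d"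
      by (simp only: p)
  next
    fix S assume S: "S \<in> Pow (prime_factors n)"
    then have S': "finite S" "\<forall>p\<in>S. prime p" using fin by auto
    have pf: "prime_factorization (\<Prod>S) = mset_set S"
      by (rule prime_factorization_prod_distinct_primes[OF S'])
    show "prime_factors (\<Prod>S) = S" using S' pf by simp
    have "prime_factorization (\<Prod>S) \<subseteq># prime_factorization n"
      unfolding pf using S
      by (intro subset_mset.order_trans[OF subset_imp_msubset_mset_set mset_set_set_mset_msubset]) auto
    moreover have "0 \<notin> S" using S' by auto
    ultimately have "\<Prod>S dvd n"
      using prime_factorization_subset_iff_dvd[of "\<Prod>S" n] n S' by auto
    moreover have "squarefree (\<Prod>S)"
      by (rule squarefree_prod_coprime)
         (use S' in \<open>auto simp: squarefree_prime primes_coprime\<close>)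
    ultimately show "\<Prod>S \<in> {d. d dvd n \<and> squarefree d}" by simp
  qed
  also have "\<dots> = (\<Sum>S\<in>Pow (prime_factors n). (-1) ^ card S * f (\<Prod>S))"
  proof (intro sum.cong refl)
    fix S assume "S \<in> Pow (prime_factors n)"
    then have "finite S" "\<forall>p\<in>S. prime p" using fin by auto
    then show "of_int (moebius (\<Prod>S)) * f (\<Prod>S) = (-1) ^ card S * f (\<Prod>S)"
      by (simp add: moebius_prod)
  qed
  finally show ?thesis .
qed

lemma sum_Pow_insert:
  assumes "finite A" "a \<notin> A"
  shows "(\<Sum>S\<in>Pow (insert a A). f S) = (\<Sum>S\<in>Pow A. f S) + (\<Sum>S\<in>Pow A. f (insert a S))"
proof -
  have "(\<Sum>S\<in>Pow (insert a A). f S) = (\<Sum>S\<in>Pow A. f S) + (\<Sum>S\<in>insert a ` Pow A. f S)"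
    unfolding Pow_insert by (rule sum.union_disjoint) (use assms in auto)
  also have "(\<Sum>S\<in>insert a ` Pow A. f S) = (\<Sum>S\<in>Pow A. f (insert a S))"
    using assms by (subst sum.reindex) (auto simp: inj_on_def)
  finally show ?thesis .
qed

lemma sum_Pow_alternating_prod:
  fixes g :: "'a \<Rightarrow> real"
  assumes "finite A"
  shows "(\<Sum>S\<in>Pow A. (-1) ^ card S * (\<Prod>a\<in>S. g a)) = (\<Prod>a\<in>A. 1 - g a)"
  using assms
proof (induction A)
  case (insert a A)
  have "(\<Sum>S\<in>Pow A. (-1) ^ card (insert a S) * (\<Prod>a\<in>insert a S. g a))
      = (\<Sum>S\<in>Pow A. - g a * ((-1) ^ card S * (\<Prod>a\<in>S. g a)))"
  proof (intro sum.cong refl)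
    fix S assume "S \<in> Pow A"
    then have "finite S" "a \<notin> S" using insert finite_subset by auto
    then show "(-1) ^ card (insert a S) * (\<Prod>a\<in>insert a S. g a) = - g a * ((-1) ^ card S * (\<Prod>a\<in>S. g a))"
      by simp
  qed
  also have "\<dots> = - g a * (\<Prod>a\<in>A. 1 - g a)"
    using insert by (simp only: sum_distrib_left[symmetric])
  finally show ?case using insert
    by (simp add: sum_Pow_insert) (simp add: algebra_simps)
qed simp

text \<open>This is, up to sign, the derivative at \<open>s = 1\<close> of the expansion of the
  product of \<open>1 - p^(-s)\<close> over \<open>A\<close>: the logarithmic derivative of one
  factor is \<open>ln p / (p^s - 1)\<close>. The induction splits the subsets according to whether
  they contain the new element.\<close>

lemma sum_Pow_alternating_ln:
  assumes "finite A" "\<forall>p\<in>A. p > (1::nat)"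
  shows "(\<Sum>S\<in>Pow A. (-1) ^ card S * ((\<Prod>p\<in>S. 1 / real p) * (\<Sum>p\<in>S. ln (real p))))
       = - (\<Prod>p\<in>A. 1 - 1 / real p) * (\<Sum>p\<in>A. ln (real p) / (real p - 1))"
  using assms
proof (induction A)
  case (insert a A)
  have "(\<Sum>S\<in>Pow A. (-1) ^ card (insert a S) *
          ((\<Prod>p\<in>insert a S. 1 / real p) * (\<Sum>p\<in>insert a S. ln (real p))))
      = (\<Sum>S\<in>Pow A. - (1 / real a) * (ln (real a) * ((-1) ^ card S * (\<Prod>p\<in>S. 1 / real p))
           + (-1) ^ card S * ((\<Prod>p\<in>S. 1 / real p) * (\<Sum>p\<in>S. ln (real p)))))"
  proof (intro sum.cong refl)
    fix S assume "S \<in> Pow A"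
    then have "finite S" "a \<notin> S" using insert finite_subset by auto
    then show "(-1) ^ card (insert a S) *
          ((\<Prod>p\<in>insert a S. 1 / real p) * (\<Sum>p\<in>insert a S. ln (real p)))
      = - (1 / real a) * (ln (real a) * ((-1) ^ card S * (\<Prod>p\<in>S. 1 / real p))
           + (-1) ^ card S * ((\<Prod>p\<in>S. 1 / real p) * (\<Sum>p\<in>S. ln (real p))))"
      by (simp add: algebra_simps diff_divide_distrib add_divide_distrib)
  qed
  also have "\<dots> = - (1 / real a) * (ln (real a) * (\<Prod>p\<in>A. 1 - 1 / real p)
      - (\<Prod>p\<in>A. 1 - 1 / real p) * (\<Sum>p\<in>A. ln (real p) / (real p - 1)))"
    using insert sum_Pow_alternating_prod[of A "\<lambda>p. 1 / real p"]
    by (simp only: sum.distrib sum_distrib_left[symmetric]) simp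
  finally have *: "(\<Sum>S\<in>Pow (insert a A). (-1) ^ card S * ((\<Prod>p\<in>S. 1 / real p) * (\<Sum>p\<in>S. ln (real p))))
     = - (\<Prod>p\<in>A. 1 - 1 / real p) * (\<Sum>p\<in>A. ln (real p) / (real p - 1)) + \<dots>"
    using insert by (simp add: sum_Pow_insert)
  have "real a > 1" using insert by simp
  then show ?case unfolding * using insert by (simp add: field_simps)
qed simp

lemma sum_moebius:
  assumes "n > 0"
  shows "(\<Sum>d | d dvd n. moebius d) = (if n = 1 then 1 else 0)"
proof -
  have "real_of_int (\<Sum>d | d dvd n. moebius d) = (\<Prod>p\<in>prime_factors n. 1 - 1)"
    using sum_moebius_dvd[OF assms, of "\<lambda>_. 1"]
      sum_Pow_alternating_prod[of "prime_factors n" "\<lambda>_. 1"] by simp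
  also have "\<dots> = (if n = 1 then 1 else 0)"
    using assms by (simp add: prod_constant card_0_eq prime_factorization_empty_iff power_0_left)
  finally show ?thesis by (simp split: if_splits flip: of_int_sum)
qed

text \<open>The sum of \<open>moebius d\<close> over the common divisors \<open>d\<close> of
  \<open>a\<close> and \<open>q\<close> is the indicator of coprimality. The inner sum on the left
  runs over the multiples of \<open>d\<close> up to \<open>q\<close>, so exchanging the summations
  gives the claim.\<close>

lemma sum_coprime_moebius:
  fixes f :: "nat \<Rightarrow> real"
  assumes q: "q > 0"
  shows "(\<Sum>d | d dvd q. of_int (moebius d) * (\<Sum>b\<in>{1..q div d}. f (d * b)))
       = (\<Sum>a\<in>totatives q. f a)"
proof -
  have fin: "finite {d. d dvd q}" using q by simp
  have "(\<Sum>b\<in>{1..q div d}. f (d * b)) = (\<Sum>a\<in>{1..q}. if d dvd a then f a else 0)"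
    if d: "d dvd q" for d
  proof -
    have d0: "d > 0" using d q by (auto intro: Nat.gr0I)
    have "(\<Sum>b\<in>{1..q div d}. f (d * b)) = (\<Sum>a\<in>{a\<in>{1..q}. d dvd a}. f a)"
    proof (rule sum.reindex_bij_witness[of _ "\<lambda>a. a div d" "\<lambda>b. d * b"])
      fix b assume b: "b \<in> {1..q div d}"
      have "d * b \<le> d * (q div d)" using b by simp
      then have "d * b \<le> q" using d by simp
      then show "d * b \<in> {a \<in> {1..q}. d dvd a}" using b d0 by (auto simp: Suc_le_eq)
    next
      fix a assume a: "a \<in> {a \<in> {1..q}. d dvd a}"
      then show "a div d \<in> {1..q div d}" using d0
        by (auto simp: div_le_mono Suc_le_eq div_greater_zero_iff dvd_imp_le)
    qed (use d0 in auto)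
    then show ?thesis by (simp add: sum.If_cases Int_def)
  qed
  then have "(\<Sum>d | d dvd q. of_int (moebius d) * (\<Sum>b\<in>{1..q div d}. f (d * b)))
      = (\<Sum>d | d dvd q. \<Sum>a\<in>{1..q}. if d dvd a then of_int (moebius d) * f a else 0)"
    by (intro sum.cong refl) (auto simp: sum_distrib_left if_distrib cong: if_cong)
  also have "\<dots> = (\<Sum>a\<in>{1..q}. \<Sum>d | d dvd q. if d dvd a then of_int (moebius d) * f a else 0)"
    by (rule sum.swap)
  also have "\<dots> = (\<Sum>a\<in>{1..q}. if coprime a q then f a else 0)"
  proof (intro sum.cong refl)
    fix a assume a: "a \<in> {1..q}"
    have "(\<Sum>d | d dvd q. if d dvd a then of_int (moebius d) * f a else 0)
        = (\<Sum>d | d dvd gcd a q. of_int (moebius d) * f a)"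
      by (rule sum.mono_neutral_cong_right) (use q in auto)
    also have "\<dots> = of_int (\<Sum>d | d dvd gcd a q. moebius d) * f a"
      by (simp add: sum_distrib_right)
    also have "\<dots> = (if coprime a q then f a else 0)"
    proof (cases "coprime a q")
      case False
      then have "gcd a q \<noteq> 1" by (metis coprime_iff_gcd_eq_1)
      then show ?thesis using q False sum_moebius[of "gcd a q"] by simp
    qed (use sum_moebius[of 1] in simp)
    finally show "(\<Sum>d | d dvd q. if d dvd a then of_int (moebius d) * f a else 0)
        = (if coprime a q then f a else 0)" .
  qed
  also have "\<dots> = (\<Sum>a\<in>totatives q. f a)"
    by (rule sum.mono_neutral_cong_right) (auto simp: in_totatives_iff)
  finally show ?thesis .
qed

lemma sum_moebius_div:
  assumes q: "q > 0"
  shows "(\<Sum>d | d dvd q. of_int (moebius d) / real d) = real (totient q) / real q"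
proof -
  have "(\<Sum>d | d dvd q. of_int (moebius d) * (1 / real d)) = (\<Prod>p\<in>prime_factors q. 1 - 1 / real p)"
    by (subst sum_moebius_dvd[OF q], subst sum_Pow_alternating_prod[symmetric])
       (auto simp: prod_dividef)
  then show ?thesis using q by (simp add: totient_formula2)
qed

text \<open>With \<open>ln (q / d) = ln q - ln d\<close> the sum splits into the Euler product for
  \<open>totient q / q\<close> and its logarithmic derivative, which contributes the terms
  \<open>ln p / (p - 1)\<close>.\<close>

lemma sum_moebius_div_ln:
  assumes q: "q > 0"
  shows "(\<Sum>d | d dvd q. of_int (moebius d) / real d * ln (real (q div d)))
       = real (totient q) / real q *
          (ln (real q) + (\<Sum>p\<in>prime_factors q. ln (real p) / (real p - 1)))"
proof -
  have "(\<Sum>d | d dvd q. of_int (moebius d) * (1 / real d * ln (real d)))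
      = (\<Sum>S\<in>Pow (prime_factors q). (-1) ^ card S * ((\<Prod>p\<in>S. 1 / real p) * (\<Sum>p\<in>S. ln (real p))))"
    unfolding sum_moebius_dvd[OF q]
  proof (intro sum.cong refl)
    fix S assume S: "S \<in> Pow (prime_factors q)"
    then have "finite S" "\<forall>p\<in>S. p > 0" using finite_subset by (blast, fastforce intro: prime_gt_0_nat)
    then show "(-1) ^ card S * (1 / real (\<Prod>S) * ln (real (\<Prod>S)))
       = (-1) ^ card S * ((\<Prod>p\<in>S. 1 / real p) * (\<Sum>p\<in>S. ln (real p)))"
      by (simp add: ln_prod prod_dividef)
  qed
  also have "\<dots> = - (\<Prod>p\<in>prime_factors q. 1 - 1 / real p) * (\<Sum>p\<in>prime_factors q. ln (real p) / (real p - 1))"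
    by (rule sum_Pow_alternating_ln) (auto intro!: prime_gt_1_nat[unfolded One_nat_def])
  also have "(\<Prod>p\<in>prime_factors q. 1 - 1 / real p) = real (totient q) / real q"
    using q by (simp add: totient_formula2)
  finally have 1: "(\<Sum>d | d dvd q. of_int (moebius d) * (1 / real d * ln (real d)))
     = - (real (totient q) / real q) * (\<Sum>p\<in>prime_factors q. ln (real p) / (real p - 1))" .
  have "(\<Sum>d | d dvd q. of_int (moebius d) / real d * ln (real (q div d)))
      = (\<Sum>d | d dvd q. of_int (moebius d) / real d * ln (real q)
            - of_int (moebius d) * (1 / real d * ln (real d)))"
  proof (intro sum.cong refl)
    fix d assume "d \<in> {d. d dvd q}"
    then have "d > 0" "real (q div d) = real q / real d"
      using q by (auto intro: Nat.gr0I simp: real_of_nat_div)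
    then have *: "ln (real (q div d)) = ln (real q) - ln (real d)" using q by (simp add: ln_div)
    show "of_int (moebius d) / real d * ln (real (q div d))
        = of_int (moebius d) / real d * ln (real q) - of_int (moebius d) * (1 / real d * ln (real d))"
      unfolding * by (simp add: algebra_simps diff_divide_distrib)
  qed
  also have "\<dots> = real (totient q) / real q * ln (real q) - (- (real (totient q) / real q) * (\<Sum>p\<in>prime_factors q. ln (real p) / (real p - 1)))"
    unfolding sum_subtractf 1 sum_distrib_right[symmetric] sum_moebius_div[OF q] ..
  finally show ?thesis by (simp add: algebra_simps)
qed

section \<open>Bernoulli polynomials and power sums over totatives\<close>

lemma bernoulli_poly_Suc_diff:
  "bernoulli_poly n (x + 1) - bernoulli_poly n x = real n * x ^ (n - 1)"
proof -
  define D where "D = fps_exp (1::real) - 1"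
  have D0: "D \<noteq> 0"
  proof
    assume "D = 0"
    then have "fps_nth D 1 = 0" by simp
    then show False by (simp add: D_def)
  qed
  \<comment> \<open>Since \<open>D\<close>, that is \<open>exp t - 1\<close>, has order at most 1,
    it divides \<open>fps_X\<close>. Both quotients are therefore exact and may be subtracted; the
    factor \<open>D\<close> of the difference then cancels the denominator.\<close>
  have "subdegree D \<le> 1" by (rule subdegree_leI) (simp add: D_def)
  then have "D dvd fps_X" using D0 by (subst fps_dvd_iff) auto
  then have dvd: "D dvd fps_X * A" for A by (rule dvd_mult2)
  have "fps_X * fps_exp (x + 1) - fps_X * fps_exp x = (fps_X * fps_exp x) * D"
    unfolding D_def fps_exp_add_mult by (simp add: algebra_simps)
  then have "fps_X * fps_exp (x + 1) / D - fps_X * fps_exp x / D = fps_X * fps_exp x"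
    using D0 by (simp flip: div_diff[OF dvd dvd])
  then have "fps_nth (fps_X * fps_exp (x + 1) / D) n - fps_nth (fps_X * fps_exp x / D) n
      = fps_nth (fps_X * fps_exp x) n"
    by (metis fps_sub_nth)
  then have "bernoulli_poly n (x + 1) - bernoulli_poly n x = fact n * fps_nth (fps_X * fps_exp x) n"
    by (simp add: bernoulli_poly_def D_def flip: right_diff_distrib)
  also have "\<dots> = real n * x ^ (n - 1)"
    by (cases n) simp_all
  finally show ?thesis .
qed

lemma bernoulli_poly_sum_powers:
  "bernoulli_poly n (real k + 1) - bernoulli_poly n 1 = real n * (\<Sum>m=1..k. real m ^ (n - 1))"
proof (induction k)
  case (Suc k)
  then show ?case using bernoulli_poly_Suc_diff[of n "real k + 1"] by (simp add: algebra_simps)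
qed simp

text \<open>With \<open>d = q div k\<close>, the weight \<open>(q / k) ^ (n - 1)\<close> turns
  \<open>m ^ (n - 1)\<close> into \<open>(d * m) ^ (n - 1)\<close>, which is the shape needed for
  Moebius inversion. For \<open>n = 0\<close> both sides vanish.\<close>

lemma coprime_bernoulli_sum_eq:
  assumes q: "q > 0"
  shows "coprime_bernoulli_sum q n = real n * (\<Sum>a\<in>totatives q. real a ^ (n - 1))"
proof -
  have "coprime_bernoulli_sum q n = (\<Sum>k | k dvd q. of_int (moebius (q div k)) * (real q / real k) ^ (n - 1) *
        (real n * (\<Sum>m=1..k. real m ^ (n - 1))))"
    unfolding coprime_bernoulli_sum_def bernoulli_poly_sum_powers ..
  also have "\<dots> = (\<Sum>d | d dvd q. of_int (moebius d) * real d ^ (n - 1) *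
        (real n * (\<Sum>m=1..q div d. real m ^ (n - 1))))"
    by (rule sum.reindex_bij_witness[of _ "\<lambda>d. q div d" "\<lambda>k. q div k"])
       (use q in \<open>auto simp: div_div_eq_right real_of_nat_div\<close>)
  also have "\<dots> = real n * (\<Sum>d | d dvd q. of_int (moebius d) * (\<Sum>m=1..q div d. real (d * m) ^ (n - 1)))"
    by (simp add: sum_distrib_left power_mult_distrib mult_ac)
  also have "\<dots> = real n * (\<Sum>a\<in>totatives q. real a ^ (n - 1))"
    using sum_coprime_moebius[OF q, of "\<lambda>a. real a ^ (n - 1)"] by simp
  finally show ?thesis .
qed

section \<open>The digamma function\<close>

text \<open>It identifies \<open>coeff_a n\<close> as the Taylor coefficients of
  \<open>- Digamma\<close> at 1.\<close>

lemma Polygamma_1_eq_coeff_a: "Polygamma n (1::real) = - fact n * coeff_a n"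
proof (cases "n = 0")
  case False
  have "inverse ((1 + real k) ^ Suc n) = 1 / real (Suc k) powr (real n + 1)" for k
    using powr_realpow[of "real (Suc k)" "Suc n"] by (simp add: add.commute inverse_eq_divide)
  then show ?thesis using False by (simp add: Polygamma_def coeff_a_def zeta_def)
qed (simp add: coeff_a_def)

text \<open>The unit disc around 1 contains no pole of \<psi>, so the Taylor series at 1 converges
  there. The expansion is done over the complex numbers and then restricted to real
  arguments.\<close>

lemma coeff_a_sums_Digamma:
  assumes x: "\<bar>x\<bar> < (1::real)"
  shows "(\<lambda>n. coeff_a n * x ^ n) sums (- Digamma (1 + x))"
proof -
  have avoid: "ball (1::complex) 1 \<inter> \<int>\<^sub>\<le>\<^sub>0 = {}"
  proof -
    have "\<not> dist (1::complex) z < 1" if "z \<in> \<int>\<^sub>\<le>\<^sub>0" for z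
    proof -
      obtain k where k: "z = - of_nat k" using \<open>z \<in> \<int>\<^sub>\<le>\<^sub>0\<close> by (auto elim: nonpos_Ints_cases')
      have "Re (1 - z) \<le> norm (1 - z)" by (rule complex_Re_le_cmod)
      then show ?thesis by (simp add: k dist_norm)
    qed
    then show ?thesis by auto
  qed
  have "complex_of_real (1 + x) \<in> ball 1 1" using x by (simp add: dist_norm)
  then have "(\<lambda>n. (deriv ^^ n) Digamma 1 / fact n * (complex_of_real (1 + x) - 1) ^ n)
      sums Digamma (complex_of_real (1 + x))"
    by (intro holomorphic_power_series[of _ 1 1] holomorphic_on_Polygamma avoid)
  moreover have "(deriv ^^ n) Digamma 1 / fact n * (complex_of_real (1 + x) - 1) ^ n
      = of_real (- (coeff_a n * x ^ n))" for n
  proof -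
    have "(1::complex) \<notin> \<int>\<^sub>\<le>\<^sub>0" by (auto elim!: nonpos_Ints_cases')
    then have "(deriv ^^ n) Digamma (1::complex) = Polygamma n (of_real 1)"
      by (simp add: higher_deriv_Polygamma)
    also have "\<dots> = of_real (- fact n * coeff_a n)"
      unfolding Polygamma_1_eq_coeff_a[symmetric] by (rule Polygamma_of_real) simp
    finally show ?thesis by simp
  qed
  ultimately have "(\<lambda>n. of_real (- (coeff_a n * x ^ n))) sums complex_of_real (Digamma (1 + x))"
    using x by (subst Polygamma_of_real[symmetric]) auto
  then have "(\<lambda>n. - (coeff_a n * x ^ n)) sums Digamma (1 + x)" by (simp only: sums_of_real_iff)
  from sums_minus[OF this] show ?thesis by simp
qed

text \<open>The power series converges at \<open>(1 + \<bar>x\<bar>) / 2\<close>, which lies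
  strictly between \<open>\<bar>x\<bar>\<close> and 1, hence absolutely at \<open>x\<close>.\<close>

lemma summable_abs_coeff_a:
  assumes x: "\<bar>x\<bar> < (1::real)"
  shows "summable (\<lambda>n. \<bar>coeff_a n * x ^ n\<bar>)"
proof -
  have "\<bar>(1 + \<bar>x\<bar>) / 2\<bar> < 1" using x by simp
  then have "summable (\<lambda>n. coeff_a n * ((1 + \<bar>x\<bar>) / 2) ^ n)"
    using coeff_a_sums_Digamma by (blast intro: sums_summable)
  then have "summable (\<lambda>n. norm (coeff_a n * x ^ n))"
    by (rule powser_insidea) (use x in simp)
  then show ?thesis by simp
qed

text \<open>\<open>coeff_c\<close> is the Cauchy square of \<open>coeff_a\<close>; the sign of
  \<open>- Digamma\<close> disappears in the square.\<close>

lemma coeff_c_sums_Digamma: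
  assumes x: "\<bar>x\<bar> < (1::real)"
  shows "(\<lambda>n. coeff_c n * x ^ n) sums (Digamma (1 + x))\<^sup>2"
proof -
  have "summable (\<lambda>n. norm (coeff_a n * x ^ n))" using summable_abs_coeff_a[OF x] by simp
  then have "(\<lambda>n. \<Sum>i\<le>n. (coeff_a i * x ^ i) * (coeff_a (n - i) * x ^ (n - i)))
      sums ((\<Sum>n. coeff_a n * x ^ n) * (\<Sum>n. coeff_a n * x ^ n))"
    by (intro Cauchy_product_sums)
  also have "(\<lambda>n. \<Sum>i\<le>n. (coeff_a i * x ^ i) * (coeff_a (n - i) * x ^ (n - i))) = (\<lambda>n. coeff_c n * x ^ n)"
  proof (rule ext)
    fix n
    have "(coeff_a i * x ^ i) * (coeff_a (n - i) * x ^ (n - i)) = coeff_a i * coeff_a (n - i) * x ^ n"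
      if "i \<le> n" for i
      using that power_add[of x i "n - i"] by (simp add: mult_ac)
    then show "(\<Sum>i\<le>n. (coeff_a i * x ^ i) * (coeff_a (n - i) * x ^ (n - i))) = coeff_c n * x ^ n"
      unfolding coeff_c_def sum_distrib_right by (intro sum.cong refl) simp
  qed
  also have "(\<Sum>n. coeff_a n * x ^ n) = - Digamma (1 + x)"
    using coeff_a_sums_Digamma[OF x] by (rule sums_unique[symmetric])
  finally show ?thesis by (simp add: power2_eq_square)
qed

section \<open>Sums of digamma values and of reciprocals\<close>

text \<open>In the limit formula for \<psi> the denominators \<open>k * n + b\<close> with
  \<open>k < m\<close> and \<open>1 \<le> b \<le> n\<close> run through \<open>1, ..., m * n\<close>
  exactly once. The sum is thus the limit of \<open>n * (ln m - harm (m * n))\<close>, and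
  \<open>ln m = ln (m * n) - ln n\<close> brings in Euler's constant.\<close>

lemma sum_Digamma_div:
  assumes n: "n > 0"
  shows "(\<Sum>b=1..n. Digamma (real b / real n)) = - real n * (euler_mascheroni + ln (real n))"
proof -
  define F where "F m = (\<Sum>b=1..n. ln (real m) - (\<Sum>k<m. inverse (real b / real n + real k)))" for m
  have "F \<longlonglongrightarrow> (\<Sum>b=1..n. Digamma (real b / real n))"
    unfolding F_def
  proof (rule tendsto_sum)
    fix b assume "b \<in> {1..n}"
    then have "real b / real n \<noteq> 0" using n by simp
    from Digamma_LIMSEQ[OF this]
    show "(\<lambda>m. ln (real m) - (\<Sum>k<m. inverse (real b / real n + real k))) \<longlonglongrightarrow> Digamma (real b / real n)"
      by simp
  qed
  moreover have "F \<longlonglongrightarrow> - real n * (euler_mascheroni + ln (real n))"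
  proof -
    have F: "F m = - real n * ((harm (m * n) - ln (real (m * n))) + ln (real n))" if "m > 0" for m
    proof -
      have "(\<Sum>b=1..n. \<Sum>k<m. inverse (real b / real n + real k))
          = (\<Sum>k<m. \<Sum>b=1..n. real n * inverse (real (k * n + b)))"
        by (subst sum.swap, intro sum.cong refl) (use n in \<open>simp add: field_simps\<close>)
      also have "\<dots> = (\<Sum>k<m. real n * (harm (Suc k * n) - harm (k * n)))"
      proof (intro sum.cong refl)
        fix k
        have "harm (Suc k * n) = (harm (k * n) :: real) + (\<Sum>i\<in>{Suc (k * n)..k * n + n}. inverse (real i))"
          unfolding harm_def
          by (subst sum.union_disjoint[symmetric]) (auto intro!: sum.cong)
        also have "(\<Sum>i\<in>{Suc (k * n)..k * n + n}. inverse (real i)) = (\<Sum>b=1..n. inverse (real (k * n + b)))"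
          by (rule sum.reindex_bij_witness[of _ "\<lambda>b. k * n + b" "\<lambda>i. i - k * n"]) auto
        finally show "(\<Sum>b=1..n. real n * inverse (real (k * n + b))) = real n * (harm (Suc k * n) - harm (k * n))"
          by (simp add: sum_distrib_left)
      qed
      also have "\<dots> = real n * (\<Sum>k<m. harm (Suc k * n) - harm (k * n))" by (simp only: sum_distrib_left)
      also have "(\<Sum>k<m. harm (Suc k * n) - harm (k * n)) = (harm (m * n) - harm (0 * n) :: real)"
        by (rule sum_lessThan_telescope)
      also have "harm (0 * n) = (0::real)" by (simp add: harm_def)
      finally have "F m = real n * ln (real m) - real n * harm (m * n)"
        by (simp add: F_def sum_subtractf)
      then show ?thesis using that n by (simp add: ln_mult algebra_simps)
    qed
    have "filterlim (\<lambda>m. m * n) sequentially sequentially"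
      using n by (simp add: mult_nat_right_at_top)
    then have "(\<lambda>m. harm (m * n) - ln (real (m * n)) :: real) \<longlonglongrightarrow> euler_mascheroni"
      by (rule filterlim_compose[OF euler_mascheroni_LIMSEQ])
    then have "(\<lambda>m. - real n * ((harm (m * n) - ln (real (m * n))) + ln (real n)))
        \<longlonglongrightarrow> - real n * (euler_mascheroni + ln (real n))"
      by (intro tendsto_intros)
    moreover have "eventually (\<lambda>m. - real n * ((harm (m * n) - ln (real (m * n))) + ln (real n)) = F m) sequentially"
      using eventually_gt_at_top[of 0] by eventually_elim (simp only: F)
    ultimately show ?thesis by (rule Lim_transform_eventually)
  qed
  ultimately show ?thesis by (rule LIMSEQ_unique)
qed

lemma abs_harm_minus_ln:
  assumes "n > 0"
  shows "\<bar>harm n - ln (real n) - euler_mascheroni\<bar> \<le> 1 / real n"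
proof -
  obtain m where m: "n = Suc m" using assms gr0_implies_Suc by blast
  \<comment> \<open>The bounds for Euler's constant used below involve \<open>ln (n + 1)\<close>;
    replacing it by \<open>ln n\<close> costs at most \<open>1 / n\<close>.\<close>
  have "ln ((real n + 1) / real n) \<le> (real n + 1) / real n - 1" using assms by (intro ln_le_minus_one) simp
  then have 1: "ln (real n + 1) - ln (real n) \<le> 1 / real n" using assms by (simp add: ln_div field_simps)
  have 2: "ln (real n) \<le> ln (real n + 1)" using assms by simp
  have 3: "euler_mascheroni \<ge> harm n - ln (real n + 1) + 1 / (2 * (real n + 1))"
    using euler_mascheroni_lower[of m] by (simp add: m algebra_simps)
  have 4: "euler_mascheroni \<le> harm n - ln (real n + 1) + 1 / (2 * real n)"
    using euler_mascheroni_upper[of m] by (simp add: m algebra_simps)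
  have 5: "1 / (2 * (real n + 1)) \<ge> 0" "1 / (2 * real n) \<le> 1 / real n" using assms by (auto simp: field_simps)
  show ?thesis using 1 2 3 4 5 by linarith
qed

text \<open>Moebius inversion reduces the sum to complete sums over \<open>b / (q div d)\<close>,
  each given by Gauss's formula.\<close>

lemma sum_totatives_Digamma:
  assumes q: "q > 0"
  shows "(\<Sum>a\<in>totatives q. Digamma (real a / real q)) = - real (totient q) *
    (euler_mascheroni + (ln (real q) + (\<Sum>p\<in>prime_factors q. ln (real p) / (real p - 1))))"
proof -
  have "(\<Sum>a\<in>totatives q. Digamma (real a / real q))
      = (\<Sum>d | d dvd q. of_int (moebius d) * (\<Sum>b=1..q div d. Digamma (real (d * b) / real q)))"
    using sum_coprime_moebius[OF q, of "\<lambda>a. Digamma (real a / real q)"] by simp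
  also have "\<dots> = (\<Sum>d | d dvd q. - real q * (euler_mascheroni * (of_int (moebius d) / real d)
        + of_int (moebius d) / real d * ln (real (q div d))))"
  proof (intro sum.cong refl)
    fix d assume "d \<in> {d. d dvd q}"
    then have d: "d > 0" "q div d > 0" "real (q div d) = real q / real d"
      using q by (auto intro: Nat.gr0I simp: real_of_nat_div dvd_div_eq_0_iff)
    have "(\<Sum>b=1..q div d. Digamma (real (d * b) / real q))
        = (\<Sum>b=1..q div d. Digamma (real b / real (q div d)))"
      unfolding d(3) by (simp add: mult.commute)
    also have "\<dots> = - (real q / real d) * (euler_mascheroni + ln (real (q div d)))"
      unfolding sum_Digamma_div[OF d(2)] by (simp add: d(3))
    finally show "of_int (moebius d) * (\<Sum>b=1..q div d. Digamma (real (d * b) / real q))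
        = - real q * (euler_mascheroni * (of_int (moebius d) / real d)
            + of_int (moebius d) / real d * ln (real (q div d)))"
      by (simp only:) (simp add: algebra_simps add_divide_distrib)
  qed
  also have "\<dots> = - real q * (euler_mascheroni * (real (totient q) / real q) + real (totient q) / real q *
          (ln (real q) + (\<Sum>p\<in>prime_factors q. ln (real p) / (real p - 1))))"
    unfolding sum_distrib_left[symmetric] sum.distrib sum_moebius_div[OF q] sum_moebius_div_ln[OF q] ..
  also have "\<dots> = - real (totient q) *
    (euler_mascheroni + (ln (real q) + (\<Sum>p\<in>prime_factors q. ln (real p) / (real p - 1))))"
    using q by (simp add: field_simps)
  finally show ?thesis .
qed

text \<open>This is the only source of error. After Moebius inversion the divisor \<open>d\<close>
  contributes at most \<open>1 / d\<close> times the error \<open>d / q\<close> in the approximation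
  of \<open>harm (q div d)\<close>, that is \<open>1 / q\<close>, and there are
  \<open>num_divisors q\<close> divisors.\<close>

lemma sum_totatives_inverse_approx:
  assumes q: "q > 0"
  shows "\<bar>(\<Sum>a\<in>totatives q. 1 / real a) - real (totient q) / real q *
    (euler_mascheroni + (ln (real q) + (\<Sum>p\<in>prime_factors q. ln (real p) / (real p - 1))))\<bar>
    \<le> real (num_divisors q) / real q"
proof -
  have "(\<Sum>a\<in>totatives q. 1 / real a)
      = (\<Sum>d | d dvd q. of_int (moebius d) * (\<Sum>b=1..q div d. 1 / real (d * b)))"
    using sum_coprime_moebius[OF q, of "\<lambda>a. 1 / real a"] by simp
  also have "\<dots> = (\<Sum>d | d dvd q. of_int (moebius d) / real d * harm (q div d))"
    by (simp add: harm_def sum_distrib_left inverse_eq_divide)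
  finally have 1: "(\<Sum>a\<in>totatives q. 1 / real a) = \<dots>" .
  have "real (totient q) / real q *
    (euler_mascheroni + (ln (real q) + (\<Sum>p\<in>prime_factors q. ln (real p) / (real p - 1))))
    = (\<Sum>d | d dvd q. of_int (moebius d) / real d * euler_mascheroni)
      + (\<Sum>d | d dvd q. of_int (moebius d) / real d * ln (real (q div d)))"
    unfolding sum_distrib_right[symmetric] sum_moebius_div[OF q] sum_moebius_div_ln[OF q]
    by (rule distrib_left)
  then have "(\<Sum>a\<in>totatives q. 1 / real a) - real (totient q) / real q *
    (euler_mascheroni + (ln (real q) + (\<Sum>p\<in>prime_factors q. ln (real p) / (real p - 1))))
    = (\<Sum>d | d dvd q. of_int (moebius d) / real d * (harm (q div d) - ln (real (q div d)) - euler_mascheroni))"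
    unfolding 1 by (simp add: right_diff_distrib sum_subtractf)
  also have "\<bar>\<dots>\<bar> \<le> (\<Sum>d | d dvd q. 1 / real q)"
  proof (rule order.trans[OF sum_abs sum_mono])
    fix d assume "d \<in> {d. d dvd q}"
    then have d: "d > 0" "q div d > 0" "real (q div d) = real q / real d"
      using q by (auto intro: Nat.gr0I simp: real_of_nat_div dvd_div_eq_0_iff)
    have "\<bar>real_of_int (moebius d) / real d\<bar> \<le> 1 / real d"
      by (simp add: moebius_def power_abs)
    then have "\<bar>of_int (moebius d) / real d * (harm (q div d) - ln (real (q div d)) - euler_mascheroni)\<bar>
        \<le> 1 / real d * (1 / real (q div d))"
      unfolding abs_mult by (intro mult_mono abs_harm_minus_ln d(2)) auto
    also have "\<dots> = 1 / real q" using d by simp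
    finally show "\<bar>of_int (moebius d) / real d * (harm (q div d) - ln (real (q div d)) - euler_mascheroni)\<bar>
        \<le> 1 / real q" .
  qed
  also have "\<dots> = real (num_divisors q) / real q" by (simp add: num_divisors_def)
  finally show ?thesis .
qed

section \<open>The value of L at 1\<close>

text \<open>
  Whatever the domain of a continuation is, its value at 1 is the limit of the Dirichlet series
  along a sequence that decreases to 1.
\<close>

lemma dirichlet_L_1_eqI:
  assumes S: "open S" "connected S" "{w. 1 < Re w} \<subseteq> S" "1 \<in> S"
    and g: "g holomorphic_on S" "\<And>w. 1 < Re w \<Longrightarrow> g w = dirichlet_series X w"
  shows "dirichlet_L 1 X = g 1"
  unfolding dirichlet_L_def
proof (rule the_equality)
  show "\<exists>S f. open S \<and> connected S \<and> {w. 1 < Re w} \<subseteq> S \<and> 1 \<in> S \<and> f holomorphic_on S \<and>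
      (\<forall>w. 1 < Re w \<longrightarrow> f w = dirichlet_series X w) \<and> f 1 = g 1"
    using assms by blast
next
  fix z
  assume "\<exists>S f. open S \<and> connected S \<and> {w. 1 < Re w} \<subseteq> S \<and> 1 \<in> S \<and> f holomorphic_on S \<and>
      (\<forall>w. 1 < Re w \<longrightarrow> f w = dirichlet_series X w) \<and> f 1 = z"
  then obtain T f where T: "open T" "1 \<in> T" "f holomorphic_on T"
    "\<forall>w. 1 < Re w \<longrightarrow> f w = dirichlet_series X w" "f 1 = z" by blast
  define u where "u n = 1 + complex_of_real (inverse (real (Suc n)))" for n
  have "u \<longlonglongrightarrow> 1 + complex_of_real 0"
    unfolding u_def by (intro tendsto_intros LIMSEQ_inverse_real_of_nat)
  then have u: "u \<longlonglongrightarrow> 1" by simp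
  have lim: "(\<lambda>n. h (u n)) \<longlonglongrightarrow> h 1" if "h holomorphic_on U" "open U" "1 \<in> U" for h U
  proof -
    have "isCont h 1"
      using that holomorphic_on_imp_continuous_on continuous_on_eq_continuous_at by blast
    then show ?thesis using u by (rule isCont_tendsto_compose)
  qed
  have "1 < Re (u n)" for n by (simp add: u_def)
  then have "f (u n) = g (u n)" for n using T(4) g(2) by simp
  then have "(\<lambda>n. g (u n)) \<longlonglongrightarrow> f 1" using lim[OF T(3,1,2)] by simp
  moreover have "(\<lambda>n. g (u n)) \<longlonglongrightarrow> g 1" using lim[OF g(1) S(1,4)] .
  ultimately show "z = g 1" using T(5) LIMSEQ_unique by blast
qed

section \<open>Continuation of the Dirichlet series grouped by periods\<close>

text \<open>Mean value estimate on the segment from \<open>x\<close> to \<open>y\<close>: the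
  derivative is \<open>- s * z powr (- s - 1)\<close>, and for \<open>Re s \<ge> 0\<close> its bound
  is largest at the left end \<open>x\<close>.\<close>

lemma norm_powr_minus_diff_le:
  fixes s :: complex
  assumes xy: "0 < x" "x \<le> y" and s: "Re s \<ge> 0"
  shows "norm (of_real x powr (-s) - of_real y powr (-s)) \<le> norm s * x powr (- Re s - 1) * (y - x)"
proof -
  have seg: "\<exists>t. z = of_real t \<and> x \<le> t" if "z \<in> closed_segment (complex_of_real x) (of_real y)" for z
    using that xy by (auto simp: closed_segment_of_real closed_segment_eq_real_ivl)
  have "norm (of_real x powr (-s) - of_real y powr (-s))
      \<le> norm s * x powr (- Re s - 1) * norm (complex_of_real x - of_real y)"
  proof (rule field_differentiable_bound[where S = "closed_segment (complex_of_real x) (of_real y)"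
        and f' = "\<lambda>z. - s * z powr (- s - 1)"])
    fix z assume "z \<in> closed_segment (complex_of_real x) (of_real y)"
    then obtain t where t: "z = of_real t" "x \<le> t" using seg by blast
    have "z \<notin> \<real>\<^sub>\<le>\<^sub>0" using t xy by simp
    then show "((\<lambda>z. z powr - s) has_field_derivative - s * z powr (- s - 1))
        (at z within closed_segment (complex_of_real x) (complex_of_real y))"
      by (auto intro!: derivative_eq_intros)
    have "norm (z powr (- s - 1)) = t powr (- Re s - 1)"
      using t xy by (simp add: norm_powr_real_powr)
    also have "\<dots> \<le> x powr (- Re s - 1)" using t xy s by (intro powr_mono2') auto
    finally show "norm (- s * z powr (- s - 1)) \<le> norm s * x powr (- Re s - 1)"
      by (simp add: norm_mult mult_left_mono)
  qed auto
  also have "norm (complex_of_real x - of_real y) = y - x"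
    using xy by (simp flip: of_real_diff)
  finally show ?thesis .
qed

text \<open>
  The subtracted terms cancel for a non-principal character, since its values sum to 0 over a
  period. They turn the Dirichlet series, grouped by periods, into a series that converges
  absolutely and locally uniformly for \<open>Re s > 0\<close>.
\<close>

definition dirichlet_block :: "nat \<Rightarrow> (nat \<Rightarrow> complex) \<Rightarrow> nat \<Rightarrow> complex \<Rightarrow> complex" where
  "dirichlet_block q X n s = (\<Sum>a\<in>totatives q. X a *
     (of_real (real (n * q + a)) powr (-s) - of_real (real (Suc n * q)) powr (-s)))"

lemma norm_dirichlet_character:
  assumes "dirichlet_character q X" "q > 0"
  shows "norm (X a) \<le> 1"
proof (cases "coprime a q")
  case True
  have "totient q \<noteq> 0" using assms by simp
  then show ?thesis using power_eq_1_iff[OF dirichlet_character_power_totient[OF assms(1) True]] by simp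
qed (use dirichlet_character_eq_0[OF assms(1)] in simp)

text \<open>In each term the two arguments are at most \<open>q\<close> apart and at least
  \<open>n + 1\<close>. On the half-plane \<open>Re s > 1 / 2\<close>, which contains 1, the
  exponent \<open>- Re s - 1\<close> is below \<open>-3/2\<close>, so the bound is summable over
  \<open>n\<close>.\<close>

lemma norm_dirichlet_block_le:
  assumes X: "dirichlet_character q X" and q: "q > 0" and s: "Re s > 1 / 2"
  shows "norm (dirichlet_block q X n s) \<le> real (totient q) * real q * norm s * real (Suc n) powr (-3/2)"
proof -
  have "norm (dirichlet_block q X n s) \<le> (\<Sum>a\<in>totatives q. real q * norm s * real (Suc n) powr (-3/2))"
    unfolding dirichlet_block_def
  proof (rule sum_norm_le)
    fix a assume a: "a \<in> totatives q"
    then have a': "0 < a" "a \<le> q" by (auto simp: in_totatives_iff)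
    have "n * 1 \<le> n * q" using q by (intro mult_le_mono2) simp
    then have "Suc n \<le> n * q + a" using a' by linarith
    then have n: "real (Suc n) \<le> real (n * q + a)" by (simp only: of_nat_le_iff)
    then have pos: "0 < real (n * q + a)" using of_nat_0_less_iff[of "Suc n"] by linarith
    have "norm (X a * (of_real (real (n * q + a)) powr (-s) - of_real (real (Suc n * q)) powr (-s)))
        \<le> 1 * (norm s * real (n * q + a) powr (- Re s - 1) * (real (Suc n * q) - real (n * q + a)))"
      unfolding norm_mult
      by (intro mult_mono norm_dirichlet_character[OF X q] norm_powr_minus_diff_le) (use a' s pos in auto)
    also have "\<dots> \<le> 1 * (norm s * real (Suc n) powr (-3/2) * real q)"
    proof (intro mult_left_mono mult_mono)
      have "real (n * q + a) powr (- Re s - 1) \<le> real (Suc n) powr (- Re s - 1)"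
        by (rule powr_mono2') (use n s in auto)
      also have "\<dots> \<le> real (Suc n) powr (-3/2)" by (rule powr_mono) (use s in auto)
      finally show "real (n * q + a) powr (- Re s - 1) \<le> real (Suc n) powr (-3/2)" .
    qed (use a' in auto)
    finally show "norm (X a * (of_real (real (n * q + a)) powr (-s) - of_real (real (Suc n * q)) powr (-s)))
        \<le> real q * norm s * real (Suc n) powr (-3/2)" by (simp add: mult_ac)
  qed
  also have "\<dots> = real (totient q) * real q * norm s * real (Suc n) powr (-3/2)"
    by (simp add: totient_def)
  finally show ?thesis .
qed

text \<open>Weierstrass test: on the unit ball around \<open>x\<close> the factor
  \<open>norm y\<close> in the bound for the blocks is at most \<open>norm x + 1\<close>, so
  convergence is locally uniform.\<close>

lemma dirichlet_block_sums_holomorphic: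
  assumes X: "dirichlet_character q X" and q: "q > 0"
  obtains g where "g holomorphic_on {s. Re s > 1 / 2}"
    "\<And>s. Re s > 1 / 2 \<Longrightarrow> (\<lambda>n. dirichlet_block q X n s) sums g s"
proof -
  define S where "S = {s. Re s > 1 / 2}"
  have S: "open S" unfolding S_def by (rule open_halfspace_Re_gt)
  have hol: "dirichlet_block q X n holomorphic_on S" for n
    unfolding dirichlet_block_def[abs_def]
    by (intro holomorphic_intros)
  have sm: "summable (\<lambda>n. real (Suc n) powr (-3/2))"
    by (subst summable_Suc_iff) (simp add: summable_real_powr_iff)
  have "\<exists>g g'. \<forall>x\<in>S. (\<lambda>n. dirichlet_block q X n x) sums g x \<and>
      (\<lambda>n. deriv (dirichlet_block q X n) x) sums g' x \<and> (g has_field_derivative g' x) (at x)"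
  proof (rule series_and_derivative_comparison_local[OF S])
    show "(dirichlet_block q X n has_field_derivative deriv (dirichlet_block q X n) x) (at x)"
      if "x \<in> S" for n x
      using that S hol holomorphic_derivI by blast
  next
    fix x assume "x \<in> S"
    define h where "h n = real (totient q) * real q * (norm x + 1) * real (Suc n) powr (-3/2)" for n
    have "norm (dirichlet_block q X n y) \<le> h n" if y: "y \<in> ball x 1 \<inter> S" for n y
    proof -
      have "norm y \<le> norm x + dist x y" using norm_triangle_sub[of y x] by (simp add: dist_norm norm_minus_commute)
      then have "norm y \<le> norm x + 1" using y by simp
      then show ?thesis unfolding h_def
        using norm_dirichlet_block_le[OF X q, of y n] y
        by (intro order.trans[OF norm_dirichlet_block_le[OF X q]] mult_right_mono mult_left_mono)
           (auto simp: S_def)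
    qed
    moreover have "summable h" unfolding h_def by (intro summable_mult sm)
    ultimately show "\<exists>d h. 0 < d \<and> summable h \<and>
        (\<forall>\<^sub>F n in sequentially. \<forall>y\<in>ball x d \<inter> S. norm (dirichlet_block q X n y) \<le> h n)"
      by (intro exI[of _ 1] exI[of _ h]) auto
  qed
  then obtain g g' where "\<forall>x\<in>S. (\<lambda>n. dirichlet_block q X n x) sums g x \<and>
      (g has_field_derivative g' x) (at x)" by blast
  then show ?thesis
    using that[of g] S by (auto simp: S_def holomorphic_on_open)
qed

text \<open>For \<open>Re s > 1\<close> the Dirichlet series converges and may be grouped into
  blocks of length \<open>q\<close>. The subtracted term of a block does not depend on
  \<open>a\<close> up to the factor \<open>X a\<close>, so it vanishes on summation.\<close>

lemma dirichlet_block_sums_series: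
  assumes X: "dirichlet_character q X" "X \<noteq> principal_character q" and q: "q \<ge> 2" and s: "Re s > 1"
  shows "(\<lambda>n. dirichlet_block q X n s) sums dirichlet_series X s"
proof -
  have "summable (\<lambda>n. X (Suc n) / of_nat (Suc n) powr s)"
  proof (rule summable_comparison_test')
    show "summable (\<lambda>n. real (Suc n) powr (- Re s))"
      using s by (subst summable_Suc_iff) (simp add: summable_real_powr_iff)
    show "norm (X (Suc n) / of_nat (Suc n) powr s) \<le> real (Suc n) powr (- Re s)" for n
    proof -
      have "norm (of_nat (Suc n) powr s) = real (Suc n) powr Re s"
        by (subst norm_powr_real_powr) auto
      then show ?thesis
        using norm_dirichlet_character[OF X(1), of "Suc n"] q
        by (simp add: norm_divide powr_minus field_simps del: of_nat_Suc)
    qed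
  qed
  then have "(\<lambda>n. \<Sum>i\<in>{n * q..<n * q + q}. X (Suc i) / of_nat (Suc i) powr s) sums dirichlet_series X s"
    unfolding dirichlet_series_def by (intro sums_group summable_sums) (use q in auto)
  moreover have "(\<Sum>i\<in>{n * q..<n * q + q}. X (Suc i) / of_nat (Suc i) powr s) = dirichlet_block q X n s" for n
  proof -
    have "(\<Sum>i\<in>{n * q..<n * q + q}. X (Suc i) / of_nat (Suc i) powr s)
        = (\<Sum>a\<in>{1..q}. X (n * q + a) / of_nat (n * q + a) powr s)"
      by (rule sum.reindex_bij_witness[of _ "\<lambda>a. n * q + a - 1" "\<lambda>i. Suc i - n * q"]) auto
    also have "\<dots> = (\<Sum>a\<in>{1..q}. X a * of_nat (n * q + a) powr (-s))"
      using dirichlet_character_add_mult[OF X(1), of _ n]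
      by (intro sum.cong refl) (simp add: powr_minus divide_inverse add.commute)
    also have "\<dots> = (\<Sum>a\<in>totatives q. X a * of_nat (n * q + a) powr (-s))"
      by (rule sum.mono_neutral_right)
         (use dirichlet_character_eq_0[OF X(1)] in \<open>auto simp: in_totatives_iff\<close>)
    also have "\<dots> = (\<Sum>a\<in>totatives q. X a * of_nat (n * q + a) powr (-s))
        - (\<Sum>a\<in>totatives q. X a) * of_nat (Suc n * q) powr (-s)"
      using sum_dirichlet_character[OF q X] by simp
    also have "\<dots> = dirichlet_block q X n s"
      unfolding dirichlet_block_def sum_distrib_right sum_subtractf[symmetric]
      by (simp add: right_diff_distrib del: of_nat_add of_nat_mult)
    finally show ?thesis .
  qed
  ultimately show ?thesis by simp
qed

text \<open>The difference \<open>1 / (n * q + a) - 1 / (Suc n * q)\<close> is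
  \<open>- 1 / q\<close> times a term of the series for \<open>Digamma (a / q)\<close> plus Euler's
  constant. That constant drops out since the values of \<open>X\<close> sum to 0.\<close>

lemma dirichlet_block_1_sums:
  assumes X: "dirichlet_character q X" "X \<noteq> principal_character q" and q: "q \<ge> 2"
  shows "(\<lambda>n. dirichlet_block q X n 1) sums
    (- (\<Sum>a\<in>totatives q. X a * of_real (Digamma (real a / real q))) / of_nat q)"
proof -
  have "(\<lambda>n. X a * (of_real (real (n * q + a)) powr (-1) - of_real (real (Suc n * q)) powr (-1)))
      sums (- (1 / of_nat q) * (X a * (of_real (Digamma (real a / real q)) + of_real euler_mascheroni)))"
    if a: "a \<in> totatives q" for a
  proof -
    have a0: "a > 0" using a by (simp add: in_totatives_iff)
    then have "real a / real q \<noteq> 0" using q by simp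
    from summable_sums[OF summable_Digamma[OF this]]
    have "(\<lambda>n. inverse (real (Suc n)) - inverse (real a / real q + real n))
        sums (Digamma (real a / real q) + euler_mascheroni)"
      by (simp add: Digamma_def)
    then have "(\<lambda>n. - (1 / of_nat q) * (X a * of_real (inverse (real (Suc n)) - inverse (real a / real q + real n))))
      sums (- (1 / of_nat q) * (X a * of_real (Digamma (real a / real q) + euler_mascheroni)))"
      by (intro sums_mult sums_of_real)
    moreover have "- (1 / of_nat q) * (X a * of_real (inverse (real (Suc n)) - inverse (real a / real q + real n)))
        = X a * (of_real (real (n * q + a)) powr (-1) - of_real (real (Suc n * q)) powr (-1))" for n
    proof -
      have "of_real (real (n * q + a)) powr (-1) - of_real (real (Suc n * q)) powr (-1)
          = complex_of_real (1 / real (n * q + a) - 1 / real (Suc n * q))"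
        by (simp add: powr_minus inverse_eq_divide del: of_nat_add of_nat_mult)
      also have "1 / real (n * q + a) - 1 / real (Suc n * q)
          = - (1 / real q) * (inverse (real (Suc n)) - inverse (real a / real q + real n))"
      proof -
        define N M where "N = real (n * q + a)" and "M = real (Suc n)"
        have "N > 0" unfolding N_def of_nat_0_less_iff using a0 by simp
        moreover have "M > 0" "real q > 0" using q by (auto simp: M_def)
        moreover have "real a / real q + real n = N / real q" using q by (simp add: N_def field_simps)
        moreover have "real (Suc n * q) = M * real q" by (simp only: M_def of_nat_mult)
        ultimately show ?thesis unfolding N_def[symmetric] M_def[symmetric] by (simp add: field_simps)
      qed
      finally show ?thesis by simp
    qed
    ultimately show ?thesis by simp
  qed
  then have "(\<lambda>n. dirichlet_block q X n 1) sums (\<Sum>a\<in>totatives q.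
      - (1 / of_nat q) * (X a * (of_real (Digamma (real a / real q)) + of_real euler_mascheroni)))"
    unfolding dirichlet_block_def by (intro sums_sum) auto
  also have "(\<Sum>a\<in>totatives q.
      - (1 / of_nat q) * (X a * (of_real (Digamma (real a / real q)) + of_real euler_mascheroni)))
      = - (1 / of_nat q) * ((\<Sum>a\<in>totatives q. X a * of_real (Digamma (real a / real q)))
          + (\<Sum>a\<in>totatives q. X a) * of_real euler_mascheroni)"
    unfolding sum_distrib_left[symmetric] by (simp add: distrib_left sum.distrib sum_distrib_right)
  also have "\<dots> = - (\<Sum>a\<in>totatives q. X a * of_real (Digamma (real a / real q))) / of_nat q"
    using sum_dirichlet_character[OF q X] by simp
  finally show ?thesis .
qed

text \<open>The half-plane \<open>Re s > 1 / 2\<close> serves as the domain of continuation.\<close>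

lemma dirichlet_L_1:
  assumes X: "dirichlet_character q X" "X \<noteq> principal_character q" and q: "q \<ge> 2"
  shows "dirichlet_L 1 X = - (\<Sum>a\<in>totatives q. X a * of_real (Digamma (real a / real q))) / of_nat q"
proof -
  have "q > 0" using q by simp
  from dirichlet_block_sums_holomorphic[OF X(1) this]
  obtain g where g: "g holomorphic_on {s. Re s > 1 / 2}"
    "\<And>s. Re s > 1 / 2 \<Longrightarrow> (\<lambda>n. dirichlet_block q X n s) sums g s" by blast
  have "dirichlet_L 1 X = g 1"
  proof (rule dirichlet_L_1_eqI)
    show "open {s. Re s > 1 / 2}" by (rule open_halfspace_Re_gt)
    show "connected {s. Re s > 1 / 2}" by (intro convex_connected convex_halfspace_Re_gt)
    show "g w = dirichlet_series X w" if "1 < Re w" for w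
      using g(2)[of w] dirichlet_block_sums_series[OF X q that] that by (auto intro: sums_unique2)
  qed (use g in auto)
  also have "\<dots> = - (\<Sum>a\<in>totatives q. X a * of_real (Digamma (real a / real q))) / of_nat q"
    using g(2)[of 1] dirichlet_block_1_sums[OF X q] by (auto intro: sums_unique2)
  finally show ?thesis .
qed

section \<open>The mean square\<close>

text \<open>For \<open>x = a / q\<close> the right-hand summand is \<open>1 / x\<close> times the
  expansion of \<open>- Digamma (1 + x)\<close> without its constant term, that is the sum of
  \<open>coeff_a n * x ^ (n - 1)\<close> over \<open>n \<ge> 1\<close>. Summing over
  \<open>a\<close> termwise turns the powers of \<open>a\<close> into Bernoulli sums.\<close>

lemma sums_coeff_a_bernoulli:
  assumes q: "q \<ge> 2"
  shows "(\<lambda>n. if n = 0 then 0 else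
                 (-1) ^ n * zeta (real n + 1) * real q powi (1 - int n) / real n
                   * coprime_bernoulli_sum q n)
    sums (\<Sum>a\<in>totatives q. real q / real a * (- Digamma (1 + real a / real q) - euler_mascheroni))"
proof -
  have "(\<lambda>n. real q / real a * (coeff_a n * (real a / real q) ^ n - (if n = 0 then euler_mascheroni else 0)))
      sums (real q / real a * (- Digamma (1 + real a / real q) - euler_mascheroni))"
    if a: "a \<in> totatives q" for a
  proof -
    have "a < q" using a q totatives_less by auto
    then show ?thesis
      by (intro sums_mult sums_diff coeff_a_sums_Digamma sums_single) auto
  qed
  then have "(\<lambda>n. \<Sum>a\<in>totatives q. real q / real a *
        (coeff_a n * (real a / real q) ^ n - (if n = 0 then euler_mascheroni else 0)))
      sums (\<Sum>a\<in>totatives q. real q / real a * (- Digamma (1 + real a / real q) - euler_mascheroni))"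
    by (rule sums_sum)
  moreover have "(\<Sum>a\<in>totatives q. real q / real a *
        (coeff_a n * (real a / real q) ^ n - (if n = 0 then euler_mascheroni else 0)))
      = (if n = 0 then 0 else (-1) ^ n * zeta (real n + 1) * real q powi (1 - int n) / real n
                   * coprime_bernoulli_sum q n)" for n
  proof (cases n)
    case 0
    then show ?thesis by (simp add: coeff_a_def)
  next
    case (Suc m)
    have "(-1) ^ n * zeta (real n + 1) * real q powi (1 - int n) / real n * coprime_bernoulli_sum q n
        = coeff_a n * real q powi (1 - int n) * (\<Sum>a\<in>totatives q. real a ^ m)"
      using q Suc by (simp add: coprime_bernoulli_sum_eq coeff_a_def)
    also have "\<dots> = (\<Sum>a\<in>totatives q. coeff_a n * real q powi (1 - int n) * real a ^ m)"
      by (rule sum_distrib_left)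
    also have "\<dots> = (\<Sum>a\<in>totatives q. real q / real a * (coeff_a n * (real a / real q) ^ n))"
    proof (intro sum.cong refl)
      fix a assume "a \<in> totatives q"
      then have "real a \<noteq> 0" by (simp add: in_totatives_iff)
      moreover have "real q powi (1 - int n) = 1 / real q ^ m"
        by (simp add: Suc power_int_minus inverse_eq_divide)
      ultimately show "coeff_a n * real q powi (1 - int n) * real a ^ m
          = real q / real a * (coeff_a n * (real a / real q) ^ n)"
        using q by (simp add: Suc power_divide field_simps)
    qed
    finally show ?thesis using Suc by simp
  qed
  ultimately show ?thesis by simp
qed

lemma sums_coeff_c_bernoulli:
  assumes q: "q \<ge> 2"
  shows "(\<lambda>n. coeff_c n / (real n + 1) * real q powi (- int n) * coprime_bernoulli_sum q (n + 1))
    sums (\<Sum>a\<in>totatives q. (Digamma (1 + real a / real q))\<^sup>2)"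
proof -
  have "(\<lambda>n. coeff_c n * (real a / real q) ^ n) sums (Digamma (1 + real a / real q))\<^sup>2"
    if a: "a \<in> totatives q" for a
  proof -
    have "a < q" using a q totatives_less by auto
    then show ?thesis by (intro coeff_c_sums_Digamma) auto
  qed
  then have "(\<lambda>n. \<Sum>a\<in>totatives q. coeff_c n * (real a / real q) ^ n)
      sums (\<Sum>a\<in>totatives q. (Digamma (1 + real a / real q))\<^sup>2)"
    by (rule sums_sum)
  moreover have "(\<Sum>a\<in>totatives q. coeff_c n * (real a / real q) ^ n)
      = coeff_c n / (real n + 1) * real q powi (- int n) * coprime_bernoulli_sum q (n + 1)" for n
  proof -
    have "coprime_bernoulli_sum q (n + 1) = (real n + 1) * (\<Sum>a\<in>totatives q. real a ^ n)"
      using coprime_bernoulli_sum_eq[of q "n + 1"] q by (simp add: add.commute)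
    moreover have "(\<Sum>a\<in>totatives q. coeff_c n * (real a / real q) ^ n)
        = coeff_c n / real q ^ n * (\<Sum>a\<in>totatives q. real a ^ n)"
      by (simp add: power_divide sum_distrib_left)
    moreover have "real n + 1 \<noteq> 0" by simp
    ultimately show ?thesis by (simp add: power_int_minus inverse_eq_divide)
  qed
  ultimately show ?thesis by simp
qed

text \<open>The digamma sum \<open>P X\<close> makes sense for the principal character as well,
  although it is not an L-value there. Parseval is applied to all characters, and the principal
  term, the square of the plain digamma sum, is then removed.\<close>

lemma sum_norm_dirichlet_L_1:
  assumes q: "q \<ge> 2"
  shows "(\<Sum>X | dirichlet_character q X \<and> X \<noteq> principal_character q. (cmod (dirichlet_L 1 X))\<^sup>2)
    = (real (totient q) * (\<Sum>a\<in>totatives q. (Digamma (real a / real q))\<^sup>2)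
       - (\<Sum>a\<in>totatives q. Digamma (real a / real q))\<^sup>2) / (real q)\<^sup>2"
proof -
  define D where "D = {X. dirichlet_character q X}"
  define P where "P X = (\<Sum>a\<in>totatives q. X a * complex_of_real (Digamma (real a / real q)))" for X
  have fin: "finite D" using finite_dirichlet_characters q by (simp add: D_def)
  have "(\<Sum>X | dirichlet_character q X \<and> X \<noteq> principal_character q. (cmod (dirichlet_L 1 X))\<^sup>2)
      = (\<Sum>X\<in>D - {principal_character q}. (cmod (P X))\<^sup>2 / (real q)\<^sup>2)"
    by (intro sum.cong) (auto simp: D_def P_def dirichlet_L_1[OF _ _ q] norm_divide power_divide)
  also have "\<dots> = ((\<Sum>X\<in>D. (cmod (P X))\<^sup>2) - (cmod (P (principal_character q)))\<^sup>2) / (real q)\<^sup>2"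
    using fin by (simp add: sum_diff1 D_def flip: sum_divide_distrib)
  also have "(\<Sum>X\<in>D. (cmod (P X))\<^sup>2) = real (totient q) * (\<Sum>a\<in>totatives q. (Digamma (real a / real q))\<^sup>2)"
    unfolding D_def P_def dirichlet_character_parseval[OF q] by simp
  also have "P (principal_character q) = of_real (\<Sum>a\<in>totatives q. Digamma (real a / real q))"
    by (simp add: P_def principal_character_def in_totatives_iff)
  finally show ?thesis by (simp only: norm_of_real power2_abs)
qed

text \<open>For \<open>x = a / q\<close> one squares
  \<open>Digamma x = Digamma (1 + x) - 1 / x\<close>. The cross term
  \<open>- 2 * Digamma (1 + x) / x\<close> is split at Euler's constant: the rest has a power series
  in \<open>x\<close>, and the constant produces the sum of \<open>1 / a\<close>.\<close>

lemma sum_Digamma_square: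
  assumes q: "q > 0"
  shows "(\<Sum>a\<in>totatives q. (Digamma (real a / real q))\<^sup>2) =
     (real q)\<^sup>2 * (\<Sum>a\<in>totatives q. 1 / (real a)\<^sup>2)
     + 2 * (\<Sum>a\<in>totatives q. real q / real a * (- Digamma (1 + real a / real q) - euler_mascheroni))
     + 2 * euler_mascheroni * real q * (\<Sum>a\<in>totatives q. 1 / real a)
     + (\<Sum>a\<in>totatives q. (Digamma (1 + real a / real q))\<^sup>2)"
  unfolding sum_distrib_left sum.distrib[symmetric]
proof (intro sum.cong refl)
  fix a assume "a \<in> totatives q"
  then have a: "real a \<noteq> 0" by (simp add: in_totatives_iff)
  then have "Digamma (1 + real a / real q) = Digamma (real a / real q) + real q / real a"
    using Digamma_plus1[of "real a / real q"] q by (simp add: add.commute)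
  then have D: "Digamma (real a / real q) = Digamma (1 + real a / real q) - real q / real a" by simp
  show "(Digamma (real a / real q))\<^sup>2 =
     (real q)\<^sup>2 * (1 / (real a)\<^sup>2)
     + 2 * (real q / real a * (- Digamma (1 + real a / real q) - euler_mascheroni))
     + 2 * euler_mascheroni * real q * (1 / real a)
     + (Digamma (1 + real a / real q))\<^sup>2"
    unfolding D using a by (simp add: power2_eq_square field_simps)
qed

theorem theorem2:
  shows "\<exists>C::real. C > 0 \<and> (\<forall>q::nat. q \<ge> 3 \<longrightarrow>
    \<bar>(\<Sum>X | dirichlet_character q X \<and> X \<noteq> principal_character q. (cmod (dirichlet_L 1 X))\<^sup>2)
      - ( real (totient q) * (\<Sum>a | a \<in> {1..q} \<and> coprime a q. 1 / (real a)\<^sup>2)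
        - (real (totient q))\<^sup>2 / (real q)\<^sup>2
            * (ln (real q) + (\<Sum>p | prime p \<and> p dvd q. ln (real p) / (real p - 1)))\<^sup>2
        + euler_mascheroni\<^sup>2 * (real (totient q))\<^sup>2 / (real q)\<^sup>2
        + 2 * real (totient q) / (real q)\<^sup>2
            * (\<Sum>n. if n = 0 then 0 else
                 (-1) ^ n * zeta (real n + 1) * real q powi (1 - int n) / real n
                   * coprime_bernoulli_sum q n)
        + real (totient q) / (real q)\<^sup>2
            * (\<Sum>n. coeff_c n / (real n + 1) * real q powi (- int n)
                   * coprime_bernoulli_sum q (n + 1)))\<bar>
    \<le> C * (real (num_divisors q) * real (totient q) / (real q)\<^sup>2))"
\<comment> \<open>The constant is the coefficient of the cross term of \<open>1 / x\<close> with
  Euler's constant in the squared digamma function.\<close>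
proof (intro exI[of _ "2 * euler_mascheroni"] conjI allI impI)
  show "2 * euler_mascheroni > (0::real)" using euler_mascheroni_pos by simp
next
  fix q :: nat assume "q \<ge> 3"
  then have q2: "q \<ge> 2" and q0: "q > 0" by auto
  have tot: "{a. a \<in> {1..q} \<and> coprime a q} = totatives q"
    by (auto simp: in_totatives_iff)
  have primes: "{p. prime p \<and> p dvd q} = prime_factors q"
    using q0 by (auto simp: prime_factors_dvd)
  define \<phi> Q where "\<phi> = real (totient q)" and "Q = real q"
  define \<Lambda> where "\<Lambda> = ln (real q) + (\<Sum>p\<in>prime_factors q. ln (real p) / (real p - 1))"
  define R2 R1 where "R2 = (\<Sum>a\<in>totatives q. 1 / (real a)\<^sup>2)" and "R1 = (\<Sum>a\<in>totatives q. 1 / real a)"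
  define U V where
    "U = (\<Sum>a\<in>totatives q. real q / real a * (- Digamma (1 + real a / real q) - euler_mascheroni))" and
    "V = (\<Sum>a\<in>totatives q. (Digamma (1 + real a / real q))\<^sup>2)"
  define g where "g = (euler_mascheroni :: real)"
  have Q: "Q > 0" using q0 by (simp add: Q_def)
  have g: "g > 0" using euler_mascheroni_pos by (simp add: g_def)
  have "(\<Sum>X | dirichlet_character q X \<and> X \<noteq> principal_character q. (cmod (dirichlet_L 1 X))\<^sup>2)
      = (\<phi> * (Q\<^sup>2 * R2 + 2 * U + 2 * g * Q * R1 + V) - (- \<phi> * (g + \<Lambda>))\<^sup>2) / Q\<^sup>2"
    unfolding sum_norm_dirichlet_L_1[OF q2] sum_Digamma_square[OF q0] sum_totatives_Digamma[OF q0]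
      \<phi>_def Q_def \<Lambda>_def R1_def R2_def U_def V_def g_def ..
  \<comment> \<open>The terms with \<open>R2\<close>, \<open>U\<close>, \<open>V\<close> and
    \<Lambda>^2 cancel. One \<open>- g^2\<close> comes from the square of
    \<open>g + \<Lambda>\<close> and another from the subtracted main term; together with the mixed
    term they form \<open>- 2 * g * (g + \<Lambda>)\<close>.\<close>
  also have "\<dots> - (\<phi> * R2 - \<phi>\<^sup>2 / Q\<^sup>2 * \<Lambda>\<^sup>2 + g\<^sup>2 * \<phi>\<^sup>2 / Q\<^sup>2 + 2 * \<phi> / Q\<^sup>2 * U + \<phi> / Q\<^sup>2 * V)
      = 2 * g * \<phi> / Q * (R1 - \<phi> / Q * (g + \<Lambda>))"
    using Q by (simp add: power2_eq_square field_simps)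
  finally have eq: "(\<Sum>X | dirichlet_character q X \<and> X \<noteq> principal_character q. (cmod (dirichlet_L 1 X))\<^sup>2)
      - (\<phi> * R2 - \<phi>\<^sup>2 / Q\<^sup>2 * \<Lambda>\<^sup>2 + g\<^sup>2 * \<phi>\<^sup>2 / Q\<^sup>2 + 2 * \<phi> / Q\<^sup>2 * U + \<phi> / Q\<^sup>2 * V)
      = 2 * g * \<phi> / Q * (R1 - \<phi> / Q * (g + \<Lambda>))" .
  have "\<bar>2 * g * \<phi> / Q * (R1 - \<phi> / Q * (g + \<Lambda>))\<bar>
      \<le> 2 * g * \<phi> / Q * (real (num_divisors q) / Q)"
  proof -
    have "2 * g * \<phi> / Q \<ge> 0" using g Q by (simp add: \<phi>_def)
    moreover have "\<bar>R1 - \<phi> / Q * (g + \<Lambda>)\<bar> \<le> real (num_divisors q) / Q"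
      unfolding R1_def \<phi>_def Q_def g_def \<Lambda>_def by (rule sum_totatives_inverse_approx[OF q0])
    ultimately show ?thesis
      by (simp only: abs_mult[of "2 * g * \<phi> / Q"] abs_of_nonneg mult_left_mono)
  qed
  also have "\<dots> = 2 * g * (real (num_divisors q) * \<phi> / Q\<^sup>2)"
    by (simp add: power2_eq_square)
  finally show "\<bar>(\<Sum>X | dirichlet_character q X \<and> X \<noteq> principal_character q. (cmod (dirichlet_L 1 X))\<^sup>2)
      - ( real (totient q) * (\<Sum>a | a \<in> {1..q} \<and> coprime a q. 1 / (real a)\<^sup>2)
        - (real (totient q))\<^sup>2 / (real q)\<^sup>2
            * (ln (real q) + (\<Sum>p | prime p \<and> p dvd q. ln (real p) / (real p - 1)))\<^sup>2
        + euler_mascheroni\<^sup>2 * (real (totient q))\<^sup>2 / (real q)\<^sup>2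
        + 2 * real (totient q) / (real q)\<^sup>2
            * (\<Sum>n. if n = 0 then 0 else
                 (-1) ^ n * zeta (real n + 1) * real q powi (1 - int n) / real n
                   * coprime_bernoulli_sum q n)
        + real (totient q) / (real q)\<^sup>2
            * (\<Sum>n. coeff_c n / (real n + 1) * real q powi (- int n)
                   * coprime_bernoulli_sum q (n + 1)))\<bar>
      \<le> 2 * euler_mascheroni * (real (num_divisors q) * real (totient q) / (real q)\<^sup>2)"
    \<comment> \<open>Both infinite series of the statement converge, with sums \<open>U\<close> and
      \<open>V\<close>.\<close>
    unfolding tot primes sums_unique[OF sums_coeff_a_bernoulli[OF q2], symmetric]
      sums_unique[OF sums_coeff_c_bernoulli[OF q2], symmetric]
      R2_def[symmetric] U_def[symmetric] V_def[symmetric] \<Lambda>_def[symmetric]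
    unfolding \<phi>_def[symmetric] Q_def[symmetric] g_def[symmetric] eq .
qed

end
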